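(* There is an equivalence of categories $$\mathcal S\text{-}\mathbf{XMod}(\mathbf{RPOGrp})\simeq\mathbf{SchCat}(\mathbf{RPOGrp})$$ between the category of $\mathcal S$-crossed modules of right-preordered groups and the category of Schreier internal categories in $\mathbf{RPOGrp}$.
   Context: Groups are written additively and need not be abelian. A right-preordered group is a pair $(G,P_G)$ with $G$ a group and $P_G$ a submonoid of $G$ (the positive cone). Morphisms $(G,P_G)\to(H,P_H)$ in $\mathbf{RPOGrp}$ are group homomorphisms $f$ with $f(P_G)\subseteq P_H$. Limits are computed separately on groups and on positive cones. A split epimorphism $d:(X_1,P_1)\to(X_0,P_0)$ with section $e$ in $\mathbf{RPOGrp}$ is Schreier if $a-e(d(a))\in P_1$ for all $a\in P_1$. A Schreier internal category is an internal category in $\mathbf{RPOGrp}$ (domain $d$, codomain $c$, identities $e$, composition $m$) such that $(d,e)$ is a Schreier split epimorphism; $\mathbf{SchCat}(\mathbf{RPOGrp})$ is the category of these with internal functors. For a right-preordered group $(K,P_K)$, $[K,P_K]_{\mathcal S}:=(\mathrm{Aut}(K),\mathrm{Aut}(K)_{\le})$, with $\mathrm{Aut}(K)$ the group of all group automorphisms of $K$ and $\mathrm{Aut}(K)_\le$ the submonoid of those $f$ with $f(P_K)\subseteq P_K$. An $\mathcal S$-precrossed module consists of right-preordered groups $(X_0,P_0)$, $(X_1,P_1)$ and morphisms $\partial:(X_1,P_1)\to(X_0,P_0)$, $\mu:(X_0,P_0)\to[X_1,P_1]_{\mathcal S}$ of $\mathbf{RPOGrp}$ such that $\partial(\mu(x)(a))=x+\partial(a)-x$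 for all $a\in X_1,x\in X_0$. Morphisms are pairs $(\gamma_0:X_0\to X_0',\gamma_1:X_1\to X_1')$ of morphisms of $\mathbf{RPOGrp}$ with $\gamma_0\partial=\partial'\gamma_1$ and $\gamma_1(\mu(x)(a))=\mu'(\gamma_0(x))(\gamma_1(a))$ for all $x\in X_0$, $a\in X_1$. An $\mathcal S$-crossed module is an $\mathcal S$-precrossed module satisfying the Peiffer identity $\mu(\partial(a))(b)=a+b-a$ for all $a,b\in X_1$; $\mathcal S\text{-}\mathbf{XMod}(\mathbf{RPOGrp})$ is the full subcategory of the category of $\mathcal S$-precrossed modules on the $\mathcal S$-crossed modules. *)

theory Defs
  imports "HOL-Algebra.Bij"
begin

section \<open>Categories, functors, equivalences\<close>

text \<open>
  Categories are given by hom-families: the hom-sets need not be disjoint, so composition is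
  indexed by objects. \<open>comp_at C A B D g f\<close> is the composite of \<open>f : A \<rightarrow> B\<close> and \<open>g : B \<rightarrow> D\<close>.
\<close>

record ('o, 'm) category =
  obj :: "'o set"
  arr :: "'o \<Rightarrow> 'o \<Rightarrow> 'm set"
  ident :: "'o \<Rightarrow> 'm"
  comp_at :: "'o \<Rightarrow> 'o \<Rightarrow> 'o \<Rightarrow> 'm \<Rightarrow> 'm \<Rightarrow> 'm"

definition is_category :: "('o, 'm) category \<Rightarrow> bool" where
  "is_category C \<longleftrightarrow>
     (\<forall>A\<in>obj C. ident C A \<in> arr C A A) \<and>
     (\<forall>A\<in>obj C. \<forall>B\<in>obj C. \<forall>D\<in>obj C. \<forall>f\<in>arr C A B. \<forall>g\<in>arr C B D.
        comp_at C A B D g f \<in> arr C A D) \<and>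
     (\<forall>A\<in>obj C. \<forall>B\<in>obj C. \<forall>f\<in>arr C A B.
        comp_at C A A B f (ident C A) = f \<and> comp_at C A B B (ident C B) f = f) \<and>
     (\<forall>A\<in>obj C. \<forall>B\<in>obj C. \<forall>D\<in>obj C. \<forall>E\<in>obj C.
        \<forall>f\<in>arr C A B. \<forall>g\<in>arr C B D. \<forall>h\<in>arr C D E.
        comp_at C A B E (comp_at C B D E h g) f = comp_at C A D E h (comp_at C A B D g f))"

definition full_subcategory :: "('o, 'm) category \<Rightarrow> ('o \<Rightarrow> bool) \<Rightarrow> ('o, 'm) category" where
  "full_subcategory C P = C\<lparr>obj := {A \<in> obj C. P A}\<rparr>"

definition is_iso :: "('o, 'm) category \<Rightarrow> 'o \<Rightarrow> 'o \<Rightarrow> 'm \<Rightarrow> bool" where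
  "is_iso C A B f \<longleftrightarrow> f \<in> arr C A B \<and>
     (\<exists>g\<in>arr C B A. comp_at C A B A g f = ident C A \<and> comp_at C B A B f g = ident C B)"

record ('o, 'm, 'p, 'n) functor_data =
  on_obj :: "'o \<Rightarrow> 'p"
  on_arr :: "'o \<Rightarrow> 'o \<Rightarrow> 'm \<Rightarrow> 'n"

definition is_functor ::
  "('o, 'm) category \<Rightarrow> ('p, 'n) category \<Rightarrow> ('o, 'm, 'p, 'n) functor_data \<Rightarrow> bool" where
  "is_functor C D F \<longleftrightarrow>
     (\<forall>A\<in>obj C. on_obj F A \<in> obj D) \<and>
     (\<forall>A\<in>obj C. \<forall>B\<in>obj C. \<forall>f\<in>arr C A B. on_arr F A B f \<in> arr D (on_obj F A) (on_obj F B)) \<and>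
     (\<forall>A\<in>obj C. on_arr F A A (ident C A) = ident D (on_obj F A)) \<and>
     (\<forall>A\<in>obj C. \<forall>B\<in>obj C. \<forall>E\<in>obj C. \<forall>f\<in>arr C A B. \<forall>g\<in>arr C B E.
        on_arr F A E (comp_at C A B E g f) =
        comp_at D (on_obj F A) (on_obj F B) (on_obj F E) (on_arr F B E g) (on_arr F A B f))"

definition id_functor :: "('o, 'm, 'o, 'm) functor_data" where
  "id_functor = \<lparr>on_obj = (\<lambda>A. A), on_arr = (\<lambda>A B f. f)\<rparr>"

definition comp_functor ::
  "('p, 'n, 'q, 'k) functor_data \<Rightarrow> ('o, 'm, 'p, 'n) functor_data \<Rightarrow> ('o, 'm, 'q, 'k) functor_data"
  where
  "comp_functor G F =
     \<lparr>on_obj = (\<lambda>A. on_obj G (on_obj F A)),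
      on_arr = (\<lambda>A B f. on_arr G (on_obj F A) (on_obj F B) (on_arr F A B f))\<rparr>"

definition naturally_isomorphic ::
  "('o, 'm) category \<Rightarrow> ('p, 'n) category \<Rightarrow>
   ('o, 'm, 'p, 'n) functor_data \<Rightarrow> ('o, 'm, 'p, 'n) functor_data \<Rightarrow> bool" where
  "naturally_isomorphic C D F G \<longleftrightarrow>
     (\<exists>\<eta>. (\<forall>A\<in>obj C. is_iso D (on_obj F A) (on_obj G A) (\<eta> A)) \<and>
          (\<forall>A\<in>obj C. \<forall>B\<in>obj C. \<forall>f\<in>arr C A B.
             comp_at D (on_obj F A) (on_obj F B) (on_obj G B) (\<eta> B) (on_arr F A B f) =
             comp_at D (on_obj F A) (on_obj G A) (on_obj G B) (on_arr G A B f) (\<eta> A)))"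

definition equivalent_categories :: "('o, 'm) category \<Rightarrow> ('p, 'n) category \<Rightarrow> bool" where
  "equivalent_categories C D \<longleftrightarrow> is_category C \<and> is_category D \<and>
     (\<exists>F G. is_functor C D F \<and> is_functor D C G \<and>
        naturally_isomorphic C C (comp_functor G F) id_functor \<and>
        naturally_isomorphic D D (comp_functor F G) id_functor)"


section \<open>Right-preordered groups\<close>

text \<open>
  The group operation is written multiplicatively, following \<^theory>\<open>HOL-Algebra.Group\<close>.
  In the categories below the carriers are subsets of a type \<open>'u\<close>, which plays the role of the
  universe of small sets. To be closed under semidirect products it must be infinite, so that
  \<open>'u \<times> 'u\<close> embeds into \<open>'u\<close>.
\<close>

record 'a rpogroup = "'a monoid" +
  pos :: "'a set"

definition is_rpogroup :: "'a rpogroup \<Rightarrow> bool" where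
  "is_rpogroup G \<longleftrightarrow> group G \<and> submonoid (pos G) G"

text \<open>Maps are extensional, so that morphisms agreeing on the carrier are equal.\<close>

definition rpo_hom :: "'a rpogroup \<Rightarrow> 'b rpogroup \<Rightarrow> ('a \<Rightarrow> 'b) set" where
  "rpo_hom G H = {f \<in> hom G H \<inter> extensional (carrier G). f ` pos G \<subseteq> pos H}"

definition rpo_id :: "'a rpogroup \<Rightarrow> 'a \<Rightarrow> 'a" where
  "rpo_id G = (\<lambda>x\<in>carrier G. x)"

definition rpo_pullback ::
  "'a rpogroup \<Rightarrow> 'b rpogroup \<Rightarrow> ('a \<Rightarrow> 'c) \<Rightarrow> ('b \<Rightarrow> 'c) \<Rightarrow> ('a \<times> 'b) rpogroup" where
  "rpo_pullback G H f g =
     \<lparr>carrier = {(x, y). x \<in> carrier G \<and> y \<in> carrier H \<and> f x = g y},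
      mult = mult (G \<times>\<times> H),
      one = one (G \<times>\<times> H),
      pos = {(x, y). x \<in> pos G \<and> y \<in> pos H \<and> f x = g y}\<rparr>"

definition rpo_Aut :: "'a rpogroup \<Rightarrow> ('a \<Rightarrow> 'a) rpogroup" where
  "rpo_Aut K =
     \<lparr>carrier = carrier (AutoGroup K),
      mult = mult (AutoGroup K),
      one = one (AutoGroup K),
      pos = {f \<in> carrier (AutoGroup K). f ` pos K \<subseteq> pos K}\<rparr>"

definition schreier_split_epi ::
  "'a rpogroup \<Rightarrow> 'b rpogroup \<Rightarrow> ('a \<Rightarrow> 'b) \<Rightarrow> ('b \<Rightarrow> 'a) \<Rightarrow> bool" where
  "schreier_split_epi X1 X0 d e \<longleftrightarrow>
     d \<in> rpo_hom X1 X0 \<and> e \<in> rpo_hom X0 X1 \<and>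
     (\<forall>x\<in>carrier X0. d (e x) = x) \<and>
     (\<forall>a\<in>pos X1. a \<otimes>\<^bsub>X1\<^esub> inv\<^bsub>X1\<^esub> (e (d a)) \<in> pos X1)"


section \<open>Schreier internal categories\<close>

text \<open>
  \<open>cmp (a, b)\<close> is the composite of \<open>b\<close> followed by \<open>a\<close>, defined when \<open>dm a = cd b\<close>.
\<close>

record 'u intcat =
  ob_grp :: "'u rpogroup"
  ar_grp :: "'u rpogroup"
  dm :: "'u \<Rightarrow> 'u"
  cd :: "'u \<Rightarrow> 'u"
  idn :: "'u \<Rightarrow> 'u"
  cmp :: "'u \<times> 'u \<Rightarrow> 'u"

definition composables :: "'u intcat \<Rightarrow> ('u \<times> 'u) rpogroup" where
  "composables X = rpo_pullback (ar_grp X) (ar_grp X) (dm X) (cd X)"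

definition internal_category :: "'u intcat \<Rightarrow> bool" where
  "internal_category X \<longleftrightarrow>
     is_rpogroup (ob_grp X) \<and> is_rpogroup (ar_grp X) \<and>
     dm X \<in> rpo_hom (ar_grp X) (ob_grp X) \<and>
     cd X \<in> rpo_hom (ar_grp X) (ob_grp X) \<and>
     idn X \<in> rpo_hom (ob_grp X) (ar_grp X) \<and>
     cmp X \<in> rpo_hom (composables X) (ar_grp X) \<and>
     (\<forall>x\<in>carrier (ob_grp X). dm X (idn X x) = x \<and> cd X (idn X x) = x) \<and>
     (\<forall>(a, b)\<in>carrier (composables X). dm X (cmp X (a, b)) = dm X b \<and> cd X (cmp X (a, b)) = cd X a) \<and>
     (\<forall>a\<in>carrier (ar_grp X). cmp X (a, idn X (dm X a)) = a \<and> cmp X (idn X (cd X a), a) = a) \<and>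
     (\<forall>a b c. (a, b) \<in> carrier (composables X) \<and> (b, c) \<in> carrier (composables X) \<longrightarrow>
        cmp X (cmp X (a, b), c) = cmp X (a, cmp X (b, c)))"

definition schreier_category :: "'u intcat \<Rightarrow> bool" where
  "schreier_category X \<longleftrightarrow>
     internal_category X \<and> schreier_split_epi (ar_grp X) (ob_grp X) (dm X) (idn X)"

definition internal_functors :: "'u intcat \<Rightarrow> 'u intcat \<Rightarrow> (('u \<Rightarrow> 'u) \<times> ('u \<Rightarrow> 'u)) set" where
  "internal_functors X Y =
     {(f0, f1). f0 \<in> rpo_hom (ob_grp X) (ob_grp Y) \<and> f1 \<in> rpo_hom (ar_grp X) (ar_grp Y) \<and>
        (\<forall>a\<in>carrier (ar_grp X). dm Y (f1 a) = f0 (dm X a) \<and> cd Y (f1 a) = f0 (cd X a)) \<and>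
        (\<forall>x\<in>carrier (ob_grp X). f1 (idn X x) = idn Y (f0 x)) \<and>
        (\<forall>(a, b)\<in>carrier (composables X). f1 (cmp X (a, b)) = cmp Y (f1 a, f1 b))}"

definition SchCat :: "('u intcat, ('u \<Rightarrow> 'u) \<times> ('u \<Rightarrow> 'u)) category" where
  "SchCat =
     \<lparr>obj = {X. schreier_category X},
      arr = internal_functors,
      ident = (\<lambda>X. (rpo_id (ob_grp X), rpo_id (ar_grp X))),
      comp_at = (\<lambda>X Y Z (g0, g1) (f0, f1).
        (compose (carrier (ob_grp X)) g0 f0, compose (carrier (ar_grp X)) g1 f1))\<rparr>"


section \<open>Crossed modules\<close>

text \<open>\<open>bd : dom_grp \<rightarrow> base_grp\<close> is the boundary and \<open>act\<close> the action \<open>\<mu>\<close> of \<open>base_grp\<close> on \<open>dom_grp\<close>.\<close>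

record 'u xmod =
  base_grp :: "'u rpogroup"
  dom_grp :: "'u rpogroup"
  bd :: "'u \<Rightarrow> 'u"
  act :: "'u \<Rightarrow> 'u \<Rightarrow> 'u"

definition precrossed_module :: "'u xmod \<Rightarrow> bool" where
  "precrossed_module M \<longleftrightarrow>
     is_rpogroup (base_grp M) \<and> is_rpogroup (dom_grp M) \<and>
     bd M \<in> rpo_hom (dom_grp M) (base_grp M) \<and>
     act M \<in> rpo_hom (base_grp M) (rpo_Aut (dom_grp M)) \<and>
     (\<forall>a\<in>carrier (dom_grp M). \<forall>x\<in>carrier (base_grp M).
        bd M (act M x a) = x \<otimes>\<^bsub>base_grp M\<^esub> bd M a \<otimes>\<^bsub>base_grp M\<^esub> inv\<^bsub>base_grp M\<^esub> x)"

definition peiffer :: "'u xmod \<Rightarrow> bool" where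
  "peiffer M \<longleftrightarrow>
     (\<forall>a\<in>carrier (dom_grp M). \<forall>b\<in>carrier (dom_grp M).
        act M (bd M a) b = a \<otimes>\<^bsub>dom_grp M\<^esub> b \<otimes>\<^bsub>dom_grp M\<^esub> inv\<^bsub>dom_grp M\<^esub> a)"

definition xmod_homs :: "'u xmod \<Rightarrow> 'u xmod \<Rightarrow> (('u \<Rightarrow> 'u) \<times> ('u \<Rightarrow> 'u)) set" where
  "xmod_homs M N =
     {(g0, g1). g0 \<in> rpo_hom (base_grp M) (base_grp N) \<and> g1 \<in> rpo_hom (dom_grp M) (dom_grp N) \<and>
        (\<forall>a\<in>carrier (dom_grp M). g0 (bd M a) = bd N (g1 a)) \<and>
        (\<forall>x\<in>carrier (base_grp M). \<forall>a\<in>carrier (dom_grp M). g1 (act M x a) = act N (g0 x) (g1 a))}"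

definition S_PreXMod :: "('u xmod, ('u \<Rightarrow> 'u) \<times> ('u \<Rightarrow> 'u)) category" where
  "S_PreXMod =
     \<lparr>obj = {M. precrossed_module M},
      arr = xmod_homs,
      ident = (\<lambda>M. (rpo_id (base_grp M), rpo_id (dom_grp M))),
      comp_at = (\<lambda>M N L (h0, h1) (g0, g1).
        (compose (carrier (base_grp M)) h0 g0, compose (carrier (dom_grp M)) h1 g1))\<rparr>"

definition S_XMod :: "('u xmod, ('u \<Rightarrow> 'u) \<times> ('u \<Rightarrow> 'u)) category" where
  "S_XMod = full_subcategory S_PreXMod peiffer"

end

theory Submission
  imports Defs
begin

text \<open>
  A Schreier internal category is sent to the kernel of its domain map, with the codomain map as
  boundary and conjugation by identities as action; the Peiffer identity holds because
  \<open>ker d\<close> and \<open>ker c\<close> commute. Every arrow splits as \<open>a = (a - e (d a)) + e (d a)\<close>, the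
  Schreier condition says that this splitting respects positive cones, and the composition is
  forced to be \<open>m (a, b) = a - e (d a) + b\<close>. Hence the kernel functor is fully faithful. It is
  essentially surjective since a crossed module is recovered from the semidirect product, with
  cone \<open>P\<^sub>1 \<times> P\<^sub>0\<close>, whose pairs are coded in the infinite universe \<open>'u\<close>.
\<close>

section \<open>Fully faithful, essentially surjective functors\<close>

text \<open>The functor runs from internal categories to crossed modules because a kernel is a
  subset of a carrier that is already there: its definition involves no coding of pairs. The coding
  enters only in essential surjectivity, one object at a time, and the action of a quasi-inverse on
  morphisms comes from the general criterion below. The delicate point is the cones. Inverses of
  positive elements need not be positive, so the usual group-theoretic arguments do not show that
  conjugation by a positive identity, or the extension of a map from the kernel to all arrows, is
  positive. In both places the Schreier condition supplies positivity of \<open>a - e (d a)\<close>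
  as a whole.\<close>

lemma comp_in_arr:
  assumes "is_category C" "A \<in> obj C" "B \<in> obj C" "D \<in> obj C" "f \<in> arr C A B" "g \<in> arr C B D"
  shows "comp_at C A B D g f \<in> arr C A D"
  using assms unfolding is_category_def by blast

lemma ident_in_arr: "is_category C \<Longrightarrow> A \<in> obj C \<Longrightarrow> ident C A \<in> arr C A A"
  unfolding is_category_def by blast

lemma comp_ident_left:
  assumes "is_category C" "A \<in> obj C" "B \<in> obj C" "f \<in> arr C A B"
  shows "comp_at C A B B (ident C B) f = f"
  using assms unfolding is_category_def by blast

lemma comp_at_assoc:
  assumes "is_category C" "A \<in> obj C" "B \<in> obj C" "D \<in> obj C" "E \<in> obj C"
    "f \<in> arr C A B" "g \<in> arr C B D" "h \<in> arr C D E"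
  shows "comp_at C A B E (comp_at C B D E h g) f = comp_at C A D E h (comp_at C A B D g f)"
  using assms unfolding is_category_def by blast

lemma equivalent_categories_sym:
  "equivalent_categories C D \<Longrightarrow> equivalent_categories D C"
  unfolding equivalent_categories_def by blast

lemma is_category_full_subcategory:
  "is_category C \<Longrightarrow> is_category (full_subcategory C P)"
  unfolding is_category_def full_subcategory_def by simp

text \<open>Choose for each \<open>Y\<close> an object \<open>S Y\<close> and an isomorphism from
  \<open>F (S Y)\<close> to \<open>Y\<close>. Conjugating an arrow by these isomorphisms gives an
  arrow between objects in the image of \<open>F\<close>, and its unique preimage is the value of
  the quasi-inverse. All laws in \<open>C\<close> are checked after applying
  \<open>F\<close>.\<close>

lemma equivalence_of_fully_faithful_essentially_surjective:
  fixes C :: "('o, 'm) category" and D :: "('p, 'n) category"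
  assumes C: "is_category C" and D: "is_category D" and F: "is_functor C D F"
    and ff: "\<And>A B. A \<in> obj C \<Longrightarrow> B \<in> obj C \<Longrightarrow>
      bij_betw (on_arr F A B) (arr C A B) (arr D (on_obj F A) (on_obj F B))"
    and es: "\<And>Y. Y \<in> obj D \<Longrightarrow> \<exists>X\<in>obj C. \<exists>h. is_iso D (on_obj F X) Y h"
  shows "equivalent_categories C D"
proof -
  let ?F = "on_obj F"
  obtain S \<epsilon> where S: "\<And>Y. Y \<in> obj D \<Longrightarrow> S Y \<in> obj C"
    and \<epsilon>: "\<And>Y. Y \<in> obj D \<Longrightarrow> is_iso D (?F (S Y)) Y (\<epsilon> Y)"
    using es by metis
  have F_obj: "?F A \<in> obj D" if "A \<in> obj C" for A
    using F that unfolding is_functor_def by blast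
  have F_id: "on_arr F A A (ident C A) = ident D (?F A)" if "A \<in> obj C" for A
    using F that unfolding is_functor_def by blast
  have F_arr: "on_arr F A B f \<in> arr D (?F A) (?F B)"
    if "A \<in> obj C" "B \<in> obj C" "f \<in> arr C A B" for A B f
    using F that unfolding is_functor_def by blast
  have F_comp: "on_arr F A E (comp_at C A B E g f) =
      comp_at D (?F A) (?F B) (?F E) (on_arr F B E g) (on_arr F A B f)"
    if "A \<in> obj C" "B \<in> obj C" "E \<in> obj C" "f \<in> arr C A B" "g \<in> arr C B E" for A B E f g
    using F that unfolding is_functor_def by blast
  have faithful: "f = g" if "A \<in> obj C" "B \<in> obj C" "f \<in> arr C A B" "g \<in> arr C A B"
    "on_arr F A B f = on_arr F A B g" for A B f g
    using ff[OF that(1,2)] that(3-5) by (auto simp: bij_betw_def inj_on_def)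
  define pre where "pre A B = inv_into (arr C A B) (on_arr F A B)" for A B
  have pre_arr: "pre A B g \<in> arr C A B"
    and F_pre: "on_arr F A B (pre A B g) = g"
    if "A \<in> obj C" "B \<in> obj C" "g \<in> arr D (?F A) (?F B)" for A B g
    using ff[OF that(1,2)] that(3) unfolding pre_def
    by (auto simp: bij_betw_def inv_into_into f_inv_into_f)
  obtain \<iota> where \<iota>: "\<And>Y. Y \<in> obj D \<Longrightarrow> \<iota> Y \<in> arr D Y (?F (S Y)) \<and>
      comp_at D (?F (S Y)) Y (?F (S Y)) (\<iota> Y) (\<epsilon> Y) = ident D (?F (S Y)) \<and>
      comp_at D Y (?F (S Y)) Y (\<epsilon> Y) (\<iota> Y) = ident D Y"
    using \<epsilon> unfolding is_iso_def by metis
  have \<epsilon>_arr: "\<epsilon> Y \<in> arr D (?F (S Y)) Y" if "Y \<in> obj D" for Y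
    using \<epsilon>[OF that] unfolding is_iso_def by blast
  define \<phi> where "\<phi> Y Z g =
      comp_at D (?F (S Y)) Z (?F (S Z)) (\<iota> Z) (comp_at D (?F (S Y)) Y Z g (\<epsilon> Y))" for Y Z g
  have ge_arr: "comp_at D (?F (S Y)) Y Z g (\<epsilon> Y) \<in> arr D (?F (S Y)) Z"
    if "Y \<in> obj D" "Z \<in> obj D" "g \<in> arr D Y Z" for Y Z g
    using that by (intro comp_in_arr[OF D] F_obj S \<epsilon>_arr)
  have \<phi>_arr: "\<phi> Y Z g \<in> arr D (?F (S Y)) (?F (S Z))"
    if "Y \<in> obj D" "Z \<in> obj D" "g \<in> arr D Y Z" for Y Z g
    unfolding \<phi>_def using that \<iota> by (intro comp_in_arr[OF D] F_obj S \<epsilon>_arr ge_arr) auto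
  have \<epsilon>_\<phi>: "comp_at D (?F (S Y)) (?F (S Z)) Z (\<epsilon> Z) (\<phi> Y Z g) =
      comp_at D (?F (S Y)) Y Z g (\<epsilon> Y)"
    if YZ: "Y \<in> obj D" "Z \<in> obj D" and g: "g \<in> arr D Y Z" for Y Z g
  proof -
    have "comp_at D (?F (S Y)) (?F (S Z)) Z (\<epsilon> Z) (\<phi> Y Z g) =
        comp_at D (?F (S Y)) Z Z (comp_at D Z (?F (S Z)) Z (\<epsilon> Z) (\<iota> Z))
          (comp_at D (?F (S Y)) Y Z g (\<epsilon> Y))"
      unfolding \<phi>_def using YZ g \<iota>
      by (intro comp_at_assoc[OF D, symmetric] F_obj S \<epsilon>_arr ge_arr) auto
    also have "\<dots> = comp_at D (?F (S Y)) Y Z g (\<epsilon> Y)"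
      using \<iota>[OF YZ(2)] comp_ident_left[OF D _ _ ge_arr[OF YZ g]] YZ F_obj S by simp
    finally show ?thesis .
  qed
  \<comment> \<open>\<open>\<epsilon> Y\<close> is monic since \<open>\<iota> Y\<close> is a left
    inverse. Equalities between the conjugates \<open>\<phi>\<close> can thus be tested after
    composing with \<open>\<epsilon>\<close>, where \<open>\<epsilon>_\<phi>\<close> turns them into
    equalities of the original arrows.\<close>
  have \<epsilon>_cancel: "u = v"
    if "W \<in> obj D" "Y \<in> obj D" "u \<in> arr D W (?F (S Y))" "v \<in> arr D W (?F (S Y))"
      "comp_at D W (?F (S Y)) Y (\<epsilon> Y) u = comp_at D W (?F (S Y)) Y (\<epsilon> Y) v" for W Y u v
  proof -
    have *: "comp_at D W Y (?F (S Y)) (\<iota> Y) (comp_at D W (?F (S Y)) Y (\<epsilon> Y) w) = w"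
      if w: "w \<in> arr D W (?F (S Y))" for w
      using comp_at_assoc[OF D \<open>W \<in> obj D\<close> _ \<open>Y \<in> obj D\<close> _ w \<epsilon>_arr, of "?F (S Y)" "\<iota> Y"]
        comp_ident_left[OF D \<open>W \<in> obj D\<close> _ w] \<iota>[OF \<open>Y \<in> obj D\<close>] F_obj S \<open>Y \<in> obj D\<close>
      by simp
    from *[OF that(3)] *[OF that(4)] that(5) show ?thesis by metis
  qed
  define G where "G = \<lparr>on_obj = S, on_arr = (\<lambda>Y Z g. pre (S Y) (S Z) (\<phi> Y Z g))\<rparr>"
  have G_obj [simp]: "on_obj G = S" by (simp add: G_def)
  have G_arr: "on_arr G Y Z g \<in> arr C (S Y) (S Z)"
    and FG: "on_arr F (S Y) (S Z) (on_arr G Y Z g) = \<phi> Y Z g"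
    if "Y \<in> obj D" "Z \<in> obj D" "g \<in> arr D Y Z" for Y Z g
    using that by (simp_all add: G_def pre_arr F_pre S \<phi>_arr)
  have G: "is_functor D C G"
    unfolding is_functor_def
  proof (intro conjI ballI)
    fix Y assume Y: "Y \<in> obj D"
    show "on_obj G Y \<in> obj C" using Y S by simp
    have "\<phi> Y Y (ident D Y) = ident D (?F (S Y))"
      unfolding \<phi>_def using comp_ident_left[OF D _ Y \<epsilon>_arr[OF Y]] \<iota>[OF Y] F_obj S Y by simp
    then show "on_arr G Y Y (ident D Y) = ident C (on_obj G Y)"
      using FG[OF Y Y ident_in_arr[OF D Y]] G_arr[OF Y Y ident_in_arr[OF D Y]]
        F_id[OF S[OF Y]] ident_in_arr[OF C S[OF Y]] faithful[OF S[OF Y] S[OF Y]] by simp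
  next
    fix Y Z g assume "Y \<in> obj D" "Z \<in> obj D" "g \<in> arr D Y Z"
    then show "on_arr G Y Z g \<in> arr C (on_obj G Y) (on_obj G Z)" using G_arr by simp
  next
    fix Y Z W f g
    assume Y: "Y \<in> obj D" and Z: "Z \<in> obj D" and W: "W \<in> obj D"
      and f: "f \<in> arr D Y Z" and g: "g \<in> arr D Z W"
    note o = S[OF Y] S[OF Z] S[OF W]
    note Fo = F_obj[OF o(1)] F_obj[OF o(2)] F_obj[OF o(3)]
    have gf: "comp_at D Y Z W g f \<in> arr D Y W" using comp_in_arr[OF D Y Z W f g] .
    have "comp_at D (?F (S Y)) (?F (S W)) W (\<epsilon> W)
        (comp_at D (?F (S Y)) (?F (S Z)) (?F (S W)) (\<phi> Z W g) (\<phi> Y Z f)) =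
        comp_at D (?F (S Y)) (?F (S Z)) W
          (comp_at D (?F (S Z)) (?F (S W)) W (\<epsilon> W) (\<phi> Z W g)) (\<phi> Y Z f)"
      using comp_at_assoc[OF D Fo(1,2,3) W \<phi>_arr[OF Y Z f] \<phi>_arr[OF Z W g] \<epsilon>_arr[OF W]] by simp
    also have "\<dots> = comp_at D (?F (S Y)) Z W g
        (comp_at D (?F (S Y)) (?F (S Z)) Z (\<epsilon> Z) (\<phi> Y Z f))"
      using comp_at_assoc[OF D Fo(1,2) Z W \<phi>_arr[OF Y Z f] \<epsilon>_arr[OF Z] g] \<epsilon>_\<phi>[OF Z W g] by simp
    also have "\<dots> = comp_at D (?F (S Y)) Y W (comp_at D Y Z W g f) (\<epsilon> Y)"
      using comp_at_assoc[OF D Fo(1) Y Z W \<epsilon>_arr[OF Y] f g] \<epsilon>_\<phi>[OF Y Z f] by simp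
    also have "\<dots> = comp_at D (?F (S Y)) (?F (S W)) W (\<epsilon> W) (\<phi> Y W (comp_at D Y Z W g f))"
      using \<epsilon>_\<phi>[OF Y W gf] by simp
    finally have "\<phi> Y W (comp_at D Y Z W g f) =
        comp_at D (?F (S Y)) (?F (S Z)) (?F (S W)) (\<phi> Z W g) (\<phi> Y Z f)"
      using \<epsilon>_cancel[OF Fo(1) W comp_in_arr[OF D Fo(1,2,3) \<phi>_arr[OF Y Z f] \<phi>_arr[OF Z W g]]
          \<phi>_arr[OF Y W gf]] by simp
    then have "on_arr F (S Y) (S W) (on_arr G Y W (comp_at D Y Z W g f)) =
        on_arr F (S Y) (S W) (comp_at C (S Y) (S Z) (S W) (on_arr G Z W g) (on_arr G Y Z f))"
      using FG[OF Y W gf] FG[OF Y Z f] FG[OF Z W g]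
        F_comp[OF o(1,2,3) G_arr[OF Y Z f] G_arr[OF Z W g]] by simp
    then show "on_arr G Y W (comp_at D Y Z W g f) =
        comp_at C (on_obj G Y) (on_obj G Z) (on_obj G W) (on_arr G Z W g) (on_arr G Y Z f)"
      using faithful[OF o(1,3) G_arr[OF Y W gf]
          comp_in_arr[OF C o(1,2,3) G_arr[OF Y Z f] G_arr[OF Z W g]]] by simp
  qed
  have FG_id: "naturally_isomorphic D D (comp_functor F G) id_functor"
    unfolding naturally_isomorphic_def comp_functor_def id_functor_def
    by (rule exI[of _ \<epsilon>]) (simp add: \<epsilon> FG \<epsilon>_\<phi>)
  define \<eta> where "\<eta> A = pre (S (?F A)) A (\<epsilon> (?F A))" for A
  have \<eta>_arr: "\<eta> A \<in> arr C (S (?F A)) A" and F_\<eta>: "on_arr F (S (?F A)) A (\<eta> A) = \<epsilon> (?F A)"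
    if "A \<in> obj C" for A
    using that by (simp_all add: \<eta>_def pre_arr F_pre S F_obj \<epsilon>_arr)
  have \<eta>_iso: "is_iso C (S (?F A)) A (\<eta> A)" if A: "A \<in> obj C" for A
  proof -
    note SA = S[OF F_obj[OF A]]
    note iota = \<iota>[OF F_obj[OF A]]
    \<comment> \<open>The inverse of \<open>\<eta> A\<close> is the preimage of the inverse of its
      image; faithfulness reflects the two identities.\<close>
    define \<theta> where "\<theta> = pre A (S (?F A)) (\<iota> (?F A))"
    have \<theta>: "\<theta> \<in> arr C A (S (?F A))" "on_arr F A (S (?F A)) \<theta> = \<iota> (?F A)"
      using pre_arr[OF A SA] F_pre[OF A SA] iota by (simp_all add: \<theta>_def)
    have "comp_at C (S (?F A)) A (S (?F A)) \<theta> (\<eta> A) = ident C (S (?F A))"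
      using F_comp[OF SA A SA \<eta>_arr[OF A] \<theta>(1)] iota F_\<eta>[OF A] \<theta> F_id[OF SA]
      by (intro faithful[OF SA SA comp_in_arr[OF C SA A SA \<eta>_arr[OF A] \<theta>(1)] ident_in_arr[OF C SA]])
        simp
    moreover have "comp_at C A (S (?F A)) A (\<eta> A) \<theta> = ident C A"
      using F_comp[OF A SA A \<theta>(1) \<eta>_arr[OF A]] iota F_\<eta>[OF A] \<theta> F_id[OF A]
      by (intro faithful[OF A A comp_in_arr[OF C A SA A \<theta>(1) \<eta>_arr[OF A]] ident_in_arr[OF C A]])
        simp
    ultimately show ?thesis
      unfolding is_iso_def using \<eta>_arr[OF A] \<theta> by blast
  qed
  have GF_id: "naturally_isomorphic C C (comp_functor G F) id_functor"
    unfolding naturally_isomorphic_def comp_functor_def id_functor_def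
  proof (rule exI[of _ \<eta>], simp add: \<eta>_iso, intro ballI)
    fix A B f assume A: "A \<in> obj C" and B: "B \<in> obj C" and f: "f \<in> arr C A B"
    note FA = F_obj[OF A] and FB = F_obj[OF B] and Ff = F_arr[OF A B f]
    note SA = S[OF FA] and SB = S[OF FB] and Gf = G_arr[OF FA FB Ff]
    \<comment> \<open>\<open>F\<close> sends this square to the square
      \<open>\<epsilon>_\<phi>\<close> for \<open>F f\<close>.\<close>
    show "comp_at C (S (?F A)) (S (?F B)) B (\<eta> B) (on_arr G (?F A) (?F B) (on_arr F A B f)) =
        comp_at C (S (?F A)) A B f (\<eta> A)"
      using F_comp[OF SA SB B Gf \<eta>_arr[OF B]] F_comp[OF SA A B \<eta>_arr[OF A] f]
        F_\<eta>[OF A] F_\<eta>[OF B] FG[OF FA FB Ff] \<epsilon>_\<phi>[OF FA FB Ff]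
      by (intro faithful[OF SA B comp_in_arr[OF C SA SB B Gf \<eta>_arr[OF B]]
            comp_in_arr[OF C SA A B \<eta>_arr[OF A] f]]) simp
  qed
  show ?thesis
    unfolding equivalent_categories_def using C D F G GF_id FG_id by blast
qed

section \<open>Morphisms of right-preordered groups\<close>

lemma rpo_homI:
  assumes "f \<in> extensional (carrier G)"
    and "\<And>x. x \<in> carrier G \<Longrightarrow> f x \<in> carrier H"
    and "\<And>x y. x \<in> carrier G \<Longrightarrow> y \<in> carrier G \<Longrightarrow> f (x \<otimes>\<^bsub>G\<^esub> y) = f x \<otimes>\<^bsub>H\<^esub> f y"
    and "\<And>x. x \<in> pos G \<Longrightarrow> f x \<in> pos H"
  shows "f \<in> rpo_hom G H"
  using assms by (auto simp: rpo_hom_def hom_def)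

lemma rpo_hom_hom: "f \<in> rpo_hom G H \<Longrightarrow> f \<in> hom G H"
  by (simp add: rpo_hom_def)

lemma rpo_hom_ext: "f \<in> rpo_hom G H \<Longrightarrow> f \<in> extensional (carrier G)"
  by (simp add: rpo_hom_def)

lemma rpo_hom_carrier: "f \<in> rpo_hom G H \<Longrightarrow> x \<in> carrier G \<Longrightarrow> f x \<in> carrier H"
  by (auto simp: rpo_hom_def hom_def)

lemma rpo_hom_mult:
  "f \<in> rpo_hom G H \<Longrightarrow> x \<in> carrier G \<Longrightarrow> y \<in> carrier G \<Longrightarrow> f (x \<otimes>\<^bsub>G\<^esub> y) = f x \<otimes>\<^bsub>H\<^esub> f y"
  by (simp add: rpo_hom_def hom_def)

lemma rpo_hom_pos: "f \<in> rpo_hom G H \<Longrightarrow> x \<in> pos G \<Longrightarrow> f x \<in> pos H"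
  by (auto simp: rpo_hom_def)

lemma rpo_group: "is_rpogroup G \<Longrightarrow> group G"
  by (simp add: is_rpogroup_def)

lemma pos_carrier: "is_rpogroup G \<Longrightarrow> x \<in> pos G \<Longrightarrow> x \<in> carrier G"
  by (auto simp: is_rpogroup_def dest: submonoid.mem_carrier)

lemma pos_mult: "is_rpogroup G \<Longrightarrow> x \<in> pos G \<Longrightarrow> y \<in> pos G \<Longrightarrow> x \<otimes>\<^bsub>G\<^esub> y \<in> pos G"
  by (auto simp: is_rpogroup_def dest: submonoid.m_closed)

lemma pos_one: "is_rpogroup G \<Longrightarrow> \<one>\<^bsub>G\<^esub> \<in> pos G"
  by (auto simp: is_rpogroup_def dest: submonoid.one_closed)

lemma is_rpogroupI:
  assumes "group G" "\<And>x. x \<in> pos G \<Longrightarrow> x \<in> carrier G"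
    "\<And>x y. x \<in> pos G \<Longrightarrow> y \<in> pos G \<Longrightarrow> x \<otimes>\<^bsub>G\<^esub> y \<in> pos G" "\<one>\<^bsub>G\<^esub> \<in> pos G"
  shows "is_rpogroup G"
  using assms by (auto simp: is_rpogroup_def submonoid_def)

lemma rpo_hom_group_hom:
  "is_rpogroup G \<Longrightarrow> is_rpogroup H \<Longrightarrow> f \<in> rpo_hom G H \<Longrightarrow> group_hom G H f"
  by (simp add: group_hom_def group_hom_axioms_def rpo_group rpo_hom_hom)

lemma rpo_hom_eqI:
  assumes "f \<in> rpo_hom G H" "g \<in> rpo_hom G H'" "\<And>x. x \<in> carrier G \<Longrightarrow> f x = g x"
  shows "f = g"
  using assms by (meson extensionalityI rpo_hom_ext)

lemma rpo_id_in_hom: "is_rpogroup G \<Longrightarrow> rpo_id G \<in> rpo_hom G G"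
  by (intro rpo_homI) (auto simp: rpo_id_def pos_carrier group.is_monoid rpo_group monoid.m_closed)

lemma rpo_hom_compose:
  assumes "is_rpogroup G" "f \<in> rpo_hom G H" "g \<in> rpo_hom H K"
  shows "compose (carrier G) g f \<in> rpo_hom G K"
  using assms
  by (intro rpo_homI)
    (auto simp: compose_eq rpo_hom_carrier rpo_hom_mult rpo_hom_pos pos_carrier
      monoid.m_closed group.is_monoid rpo_group)

lemma compose_rpo_id_right: "f \<in> rpo_hom G H \<Longrightarrow> compose (carrier G) f (rpo_id G) = f"
  by (auto simp: rpo_id_def rpo_hom_carrier rpo_hom_ext intro!: compose_Id)

lemma compose_rpo_id_left: "f \<in> rpo_hom G H \<Longrightarrow> compose (carrier G) (rpo_id H) f = f"
  by (auto simp: rpo_id_def rpo_hom_carrier rpo_hom_ext intro!: Id_compose)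

lemma compose_assoc_rpo:
  "f \<in> rpo_hom G H \<Longrightarrow>
    compose (carrier G) (compose (carrier H) h g) f = compose (carrier G) h (compose (carrier G) g f)"
  by (auto simp: rpo_hom_carrier intro!: compose_assoc[symmetric])

context group
begin

text \<open>\<open>m_assoc\<close> nests products to the right, so a cancelling pair usually carries
  a tail. This rule and the next one cancel it in that position.\<close>

lemma mult_inv_cancel_left [simp]:
  "x \<in> carrier G \<Longrightarrow> y \<in> carrier G \<Longrightarrow> x \<otimes> (inv x \<otimes> y) = y"
  by (simp flip: m_assoc)

lemma inv_mult_cancel_left [simp]:
  "x \<in> carrier G \<Longrightarrow> y \<in> carrier G \<Longrightarrow> inv x \<otimes> (x \<otimes> y) = y"
  by (simp flip: m_assoc)

end

lemma mem_composables [simp]: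
  "(a, b) \<in> carrier (composables X) \<longleftrightarrow>
    a \<in> carrier (ar_grp X) \<and> b \<in> carrier (ar_grp X) \<and> dm X a = cd X b"
  by (simp add: composables_def rpo_pullback_def)

lemma mem_pos_composables [simp]:
  "(a, b) \<in> pos (composables X) \<longleftrightarrow> a \<in> pos (ar_grp X) \<and> b \<in> pos (ar_grp X) \<and> dm X a = cd X b"
  by (simp add: composables_def rpo_pullback_def)

lemma mult_composables [simp]:
  "(a, b) \<otimes>\<^bsub>composables X\<^esub> (a', b') = (a \<otimes>\<^bsub>ar_grp X\<^esub> a', b \<otimes>\<^bsub>ar_grp X\<^esub> b')"
  by (simp add: composables_def rpo_pullback_def DirProd_def)

section \<open>The two categories\<close>

locale int_cat =
  fixes X :: "'u intcat"
  assumes internal: "internal_category X"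
begin

abbreviation "Ob \<equiv> ob_grp X"
abbreviation "Ar \<equiv> ar_grp X"

lemma ob_rpo: "is_rpogroup Ob" and ar_rpo: "is_rpogroup Ar"
  and dm_hom: "dm X \<in> rpo_hom Ar Ob" and cd_hom: "cd X \<in> rpo_hom Ar Ob"
  and idn_hom: "idn X \<in> rpo_hom Ob Ar" and cmp_hom: "cmp X \<in> rpo_hom (composables X) Ar"
  using internal by (simp_all add: internal_category_def)

lemma dm_idn [simp]: "x \<in> carrier Ob \<Longrightarrow> dm X (idn X x) = x"
  and cd_idn [simp]: "x \<in> carrier Ob \<Longrightarrow> cd X (idn X x) = x"
  using internal by (simp_all add: internal_category_def)

lemma cmp_idn_right: "a \<in> carrier Ar \<Longrightarrow> cmp X (a, idn X (dm X a)) = a"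
  and cmp_idn_left: "a \<in> carrier Ar \<Longrightarrow> cmp X (idn X (cd X a), a) = a"
  using internal by (simp_all add: internal_category_def)

lemma cmp_closed:
  "a \<in> carrier Ar \<Longrightarrow> b \<in> carrier Ar \<Longrightarrow> dm X a = cd X b \<Longrightarrow> cmp X (a, b) \<in> carrier Ar"
  by (rule rpo_hom_carrier[OF cmp_hom]) simp

lemma cmp_mult:
  assumes "a \<in> carrier Ar" "b \<in> carrier Ar" "dm X a = cd X b"
    "a' \<in> carrier Ar" "b' \<in> carrier Ar" "dm X a' = cd X b'"
  shows "cmp X (a \<otimes>\<^bsub>Ar\<^esub> a', b \<otimes>\<^bsub>Ar\<^esub> b') = cmp X (a, b) \<otimes>\<^bsub>Ar\<^esub> cmp X (a', b')"
  using rpo_hom_mult[OF cmp_hom, of "(a, b)" "(a', b')"] assms by simp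

sublocale Ob: group Ob by (rule rpo_group[OF ob_rpo])
sublocale Ar: group Ar by (rule rpo_group[OF ar_rpo])
sublocale d: group_hom Ar Ob "dm X" by (rule rpo_hom_group_hom[OF ar_rpo ob_rpo dm_hom])
sublocale c: group_hom Ar Ob "cd X" by (rule rpo_hom_group_hom[OF ar_rpo ob_rpo cd_hom])
sublocale e: group_hom Ob Ar "idn X" by (rule rpo_hom_group_hom[OF ob_rpo ar_rpo idn_hom])

text \<open>With \<open>k = a - e (d a)\<close>, the composable pair \<open>(a, b)\<close> is the
  product of \<open>(k, 1)\<close> and \<open>(e (d a), b)\<close>. Composition is a homomorphism,
  and the unit laws evaluate it on both factors.\<close>

lemma cmp_eq:
  assumes a: "a \<in> carrier Ar" and b: "b \<in> carrier Ar" and ab: "dm X a = cd X b"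
  shows "cmp X (a, b) = a \<otimes>\<^bsub>Ar\<^esub> inv\<^bsub>Ar\<^esub> idn X (dm X a) \<otimes>\<^bsub>Ar\<^esub> b"
proof -
  let ?e = "idn X (dm X a)" and ?k = "a \<otimes>\<^bsub>Ar\<^esub> inv\<^bsub>Ar\<^esub> idn X (dm X a)"
  have "cmp X (?k \<otimes>\<^bsub>Ar\<^esub> ?e, \<one>\<^bsub>Ar\<^esub> \<otimes>\<^bsub>Ar\<^esub> b) =
      cmp X (?k, \<one>\<^bsub>Ar\<^esub>) \<otimes>\<^bsub>Ar\<^esub> cmp X (?e, b)"
    using a b ab by (intro cmp_mult) (simp_all flip: d.hom_inv e.hom_inv)
  moreover have "cmp X (?k, \<one>\<^bsub>Ar\<^esub>) = ?k"
    using cmp_idn_right[of ?k] a by simp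
  moreover have "cmp X (?e, b) = b"
    using cmp_idn_left[OF b] ab by simp
  ultimately show ?thesis using a b by (simp add: Ar.m_assoc)
qed

text \<open>Apply \<open>cmp X\<close> to \<open>(k, 1) (1, l) = (k, l) = (1, l) (k, 1)\<close> in the group of composable pairs.\<close>

lemma ker_dm_ker_cd_commute:
  assumes "k \<in> carrier Ar" "l \<in> carrier Ar" "dm X k = \<one>\<^bsub>Ob\<^esub>" "cd X l = \<one>\<^bsub>Ob\<^esub>"
  shows "k \<otimes>\<^bsub>Ar\<^esub> l = l \<otimes>\<^bsub>Ar\<^esub> k"
proof -
  have k: "cmp X (k, \<one>\<^bsub>Ar\<^esub>) = k" and l: "cmp X (\<one>\<^bsub>Ar\<^esub>, l) = l"
    using cmp_idn_right[of k] cmp_idn_left[of l] assms by simp_all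
  have "cmp X (k, l) = k \<otimes>\<^bsub>Ar\<^esub> l" "cmp X (k, l) = l \<otimes>\<^bsub>Ar\<^esub> k"
    using cmp_mult[of k "\<one>\<^bsub>Ar\<^esub>" "\<one>\<^bsub>Ar\<^esub>" l] cmp_mult[of "\<one>\<^bsub>Ar\<^esub>" l k "\<one>\<^bsub>Ar\<^esub>"] assms k l
    by simp_all
  then show ?thesis by simp
qed

text \<open>The element \<open>- a + e (c a)\<close> lies in the kernel of \<open>c\<close>, so it
  commutes with \<open>b\<close> in the kernel of \<open>d\<close>. Conjugation by \<open>a\<close>
  on that kernel therefore depends only on \<open>c a\<close>; for \<open>a\<close> in the kernel as
  well this is the Peiffer identity.\<close>

lemma ker_dm_conj:
  assumes a: "a \<in> carrier Ar" and b: "b \<in> carrier Ar" and b1: "dm X b = \<one>\<^bsub>Ob\<^esub>"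
  shows "idn X (cd X a) \<otimes>\<^bsub>Ar\<^esub> b \<otimes>\<^bsub>Ar\<^esub> inv\<^bsub>Ar\<^esub> idn X (cd X a) = a \<otimes>\<^bsub>Ar\<^esub> b \<otimes>\<^bsub>Ar\<^esub> inv\<^bsub>Ar\<^esub> a"
proof -
  let ?l = "inv\<^bsub>Ar\<^esub> a \<otimes>\<^bsub>Ar\<^esub> idn X (cd X a)"
  have "b \<otimes>\<^bsub>Ar\<^esub> ?l = ?l \<otimes>\<^bsub>Ar\<^esub> b"
    using a b b1 by (intro ker_dm_ker_cd_commute) simp_all
  then have "a \<otimes>\<^bsub>Ar\<^esub> (b \<otimes>\<^bsub>Ar\<^esub> ?l) \<otimes>\<^bsub>Ar\<^esub> inv\<^bsub>Ar\<^esub> idn X (cd X a) =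
      a \<otimes>\<^bsub>Ar\<^esub> (?l \<otimes>\<^bsub>Ar\<^esub> b) \<otimes>\<^bsub>Ar\<^esub> inv\<^bsub>Ar\<^esub> idn X (cd X a)" by simp
  then show ?thesis using a b by (simp add: Ar.m_assoc del: e.hom_inv c.hom_inv)
qed

end

lemma internal_functorsI:
  assumes "f0 \<in> rpo_hom (ob_grp X) (ob_grp Y)" "f1 \<in> rpo_hom (ar_grp X) (ar_grp Y)"
    and "\<And>a. a \<in> carrier (ar_grp X) \<Longrightarrow> dm Y (f1 a) = f0 (dm X a)"
    and "\<And>a. a \<in> carrier (ar_grp X) \<Longrightarrow> cd Y (f1 a) = f0 (cd X a)"
    and "\<And>x. x \<in> carrier (ob_grp X) \<Longrightarrow> f1 (idn X x) = idn Y (f0 x)"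
    and "\<And>a b. a \<in> carrier (ar_grp X) \<Longrightarrow> b \<in> carrier (ar_grp X) \<Longrightarrow> dm X a = cd X b \<Longrightarrow>
      f1 (cmp X (a, b)) = cmp Y (f1 a, f1 b)"
  shows "(f0, f1) \<in> internal_functors X Y"
  using assms unfolding internal_functors_def by auto

lemma internal_functorsD:
  assumes "(f0, f1) \<in> internal_functors X Y"
  shows "f0 \<in> rpo_hom (ob_grp X) (ob_grp Y)" "f1 \<in> rpo_hom (ar_grp X) (ar_grp Y)"
    and "\<And>a. a \<in> carrier (ar_grp X) \<Longrightarrow> dm Y (f1 a) = f0 (dm X a)"
    and "\<And>a. a \<in> carrier (ar_grp X) \<Longrightarrow> cd Y (f1 a) = f0 (cd X a)"
    and "\<And>x. x \<in> carrier (ob_grp X) \<Longrightarrow> f1 (idn X x) = idn Y (f0 x)"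
    and "\<And>a b. a \<in> carrier (ar_grp X) \<Longrightarrow> b \<in> carrier (ar_grp X) \<Longrightarrow> dm X a = cd X b \<Longrightarrow>
      f1 (cmp X (a, b)) = cmp Y (f1 a, f1 b)"
  using assms unfolding internal_functors_def by auto

lemma xmod_homsI:
  assumes "g0 \<in> rpo_hom (base_grp M) (base_grp N)" "g1 \<in> rpo_hom (dom_grp M) (dom_grp N)"
    and "\<And>a. a \<in> carrier (dom_grp M) \<Longrightarrow> g0 (bd M a) = bd N (g1 a)"
    and "\<And>x a. x \<in> carrier (base_grp M) \<Longrightarrow> a \<in> carrier (dom_grp M) \<Longrightarrow>
      g1 (act M x a) = act N (g0 x) (g1 a)"
  shows "(g0, g1) \<in> xmod_homs M N"
  using assms unfolding xmod_homs_def by auto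

lemma xmod_homsD:
  assumes "(g0, g1) \<in> xmod_homs M N"
  shows "g0 \<in> rpo_hom (base_grp M) (base_grp N)" "g1 \<in> rpo_hom (dom_grp M) (dom_grp N)"
    and "\<And>a. a \<in> carrier (dom_grp M) \<Longrightarrow> g0 (bd M a) = bd N (g1 a)"
    and "\<And>x a. x \<in> carrier (base_grp M) \<Longrightarrow> a \<in> carrier (dom_grp M) \<Longrightarrow>
      g1 (act M x a) = act N (g0 x) (g1 a)"
  using assms unfolding xmod_homs_def by auto

lemma obj_SchCat [simp]: "X \<in> obj SchCat \<longleftrightarrow> schreier_category X"
  and arr_SchCat [simp]: "arr SchCat = internal_functors"
  and ident_SchCat [simp]: "ident SchCat X = (rpo_id (ob_grp X), rpo_id (ar_grp X))"
  and comp_SchCat [simp]: "comp_at SchCat X Y Z (g0, g1) (f0, f1) =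
    (compose (carrier (ob_grp X)) g0 f0, compose (carrier (ar_grp X)) g1 f1)"
  by (simp_all add: SchCat_def)

lemma obj_S_PreXMod [simp]: "M \<in> obj S_PreXMod \<longleftrightarrow> precrossed_module M"
  and arr_S_PreXMod [simp]: "arr S_PreXMod = xmod_homs"
  and ident_S_PreXMod [simp]: "ident S_PreXMod M = (rpo_id (base_grp M), rpo_id (dom_grp M))"
  and comp_S_PreXMod [simp]: "comp_at S_PreXMod M N L (h0, h1) (g0, g1) =
    (compose (carrier (base_grp M)) h0 g0, compose (carrier (dom_grp M)) h1 g1)"
  by (simp_all add: S_PreXMod_def)

lemma is_category_SchCat: "is_category SchCat"
  unfolding is_category_def
proof (intro conjI ballI)
  fix X :: "'u intcat" assume "X \<in> obj SchCat"
  then interpret int_cat X by unfold_locales (simp add: schreier_category_def)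
  have "(rpo_id Ob, rpo_id Ar) \<in> internal_functors X X"
    by (intro internal_functorsI rpo_id_in_hom ob_rpo ar_rpo) (simp_all add: rpo_id_def cmp_closed)
  then show "ident SchCat X \<in> arr SchCat X X" by simp
next
  fix X Y Z :: "'u intcat" and f g
  assume X: "X \<in> obj SchCat" and "f \<in> arr SchCat X Y" "g \<in> arr SchCat Y Z"
  moreover obtain f0 f1 g0 g1 where fg: "f = (f0, f1)" "g = (g0, g1)" by fastforce
  ultimately have f: "(f0, f1) \<in> internal_functors X Y" and g: "(g0, g1) \<in> internal_functors Y Z"
    by simp_all
  note f' = internal_functorsD[OF f] and g' = internal_functorsD[OF g]
  interpret int_cat X using X by unfold_locales (simp add: schreier_category_def)
  have "(compose (carrier Ob) g0 f0, compose (carrier Ar) g1 f1) \<in> internal_functors X Z"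
    using f' g'
    by (intro internal_functorsI)
      (simp_all add: compose_eq cmp_closed rpo_hom_carrier[OF f'(1)] rpo_hom_carrier[OF f'(2)]
        rpo_hom_compose[OF ob_rpo f'(1) g'(1)] rpo_hom_compose[OF ar_rpo f'(2) g'(2)])
  then show "comp_at SchCat X Y Z g f \<in> arr SchCat X Z" by (simp add: fg)
next
  fix X Y :: "'u intcat" and f
  assume "f \<in> arr SchCat X Y"
  then show "comp_at SchCat X X Y f (ident SchCat X) = f"
    "comp_at SchCat X Y Y (ident SchCat Y) f = f"
    using internal_functorsD(1,2)[of "fst f" "snd f" X Y]
    by (cases f; simp add: compose_rpo_id_left compose_rpo_id_right)+
next
  fix X Y Z W :: "'u intcat" and f g h
  assume "f \<in> arr SchCat X Y"
  then show "comp_at SchCat X Y W (comp_at SchCat Y Z W h g) f =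
      comp_at SchCat X Z W h (comp_at SchCat X Y Z g f)"
    using internal_functorsD(1,2)[of "fst f" "snd f" X Y]
    by (cases f; cases g; cases h) (simp add: compose_assoc_rpo)
qed

section \<open>Automorphism groups and precrossed modules\<close>

lemma rpo_Aut_carrier:
  "\<alpha> \<in> carrier (rpo_Aut K) \<longleftrightarrow>
    \<alpha> \<in> hom K K \<and> \<alpha> \<in> extensional (carrier K) \<and> bij_betw \<alpha> (carrier K) (carrier K)"
  by (auto simp: rpo_Aut_def AutoGroup_def auto_def Bij_def)

lemma rpo_Aut_pos:
  "\<alpha> \<in> pos (rpo_Aut K) \<longleftrightarrow> \<alpha> \<in> carrier (rpo_Aut K) \<and> \<alpha> ` pos K \<subseteq> pos K"
  by (simp add: rpo_Aut_def)

lemma rpo_Aut_mult: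
  "\<alpha> \<in> carrier (rpo_Aut K) \<Longrightarrow> \<beta> \<in> carrier (rpo_Aut K) \<Longrightarrow>
    \<alpha> \<otimes>\<^bsub>rpo_Aut K\<^esub> \<beta> = compose (carrier K) \<alpha> \<beta>"
  by (simp add: rpo_Aut_def AutoGroup_def auto_def BijGroup_def)

locale pre_xmod =
  fixes M :: "'u xmod"
  assumes precrossed: "precrossed_module M"
begin

abbreviation "B \<equiv> base_grp M"
abbreviation "K \<equiv> dom_grp M"

lemma base_rpo: "is_rpogroup B" and dom_rpo: "is_rpogroup K"
  and bd_hom: "bd M \<in> rpo_hom K B" and act_hom: "act M \<in> rpo_hom B (rpo_Aut K)"
  using precrossed by (simp_all add: precrossed_module_def)

sublocale B: group B by (rule rpo_group[OF base_rpo])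
sublocale K: group K by (rule rpo_group[OF dom_rpo])
sublocale bd: group_hom K B "bd M" by (rule rpo_hom_group_hom[OF dom_rpo base_rpo bd_hom])

lemma bd_act: "a \<in> carrier K \<Longrightarrow> x \<in> carrier B \<Longrightarrow>
    bd M (act M x a) = x \<otimes>\<^bsub>B\<^esub> bd M a \<otimes>\<^bsub>B\<^esub> inv\<^bsub>B\<^esub> x"
  using precrossed by (simp add: precrossed_module_def)

lemma act_closed [simp]: "x \<in> carrier B \<Longrightarrow> a \<in> carrier K \<Longrightarrow> act M x a \<in> carrier K"
  using rpo_hom_carrier[OF act_hom] by (auto simp: rpo_Aut_carrier hom_def)

lemma act_mult [simp]: "x \<in> carrier B \<Longrightarrow> a \<in> carrier K \<Longrightarrow> b \<in> carrier K \<Longrightarrow>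
    act M x (a \<otimes>\<^bsub>K\<^esub> b) = act M x a \<otimes>\<^bsub>K\<^esub> act M x b"
  using rpo_hom_carrier[OF act_hom] by (auto simp: rpo_Aut_carrier hom_def)

lemma act_act [simp]: "x \<in> carrier B \<Longrightarrow> y \<in> carrier B \<Longrightarrow> a \<in> carrier K \<Longrightarrow>
    act M (x \<otimes>\<^bsub>B\<^esub> y) a = act M x (act M y a)"
  using rpo_hom_mult[OF act_hom, of x y] rpo_hom_carrier[OF act_hom]
  by (simp add: rpo_Aut_mult compose_eq)

lemma act_pos: "x \<in> pos B \<Longrightarrow> a \<in> pos K \<Longrightarrow> act M x a \<in> pos K"
  using rpo_hom_pos[OF act_hom] by (auto simp: rpo_Aut_pos)

text \<open>The unit acts by an idempotent injective map, hence by the identity. The argument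
  bypasses the group structure of \<open>rpo_Aut K\<close>.\<close>

lemma act_unit [simp]:
  assumes a: "a \<in> carrier K"
  shows "act M \<one>\<^bsub>B\<^esub> a = a"
proof -
  have "inj_on (act M \<one>\<^bsub>B\<^esub>) (carrier K)"
    using rpo_hom_carrier[OF act_hom, of "\<one>\<^bsub>B\<^esub>"] by (simp add: rpo_Aut_carrier bij_betw_def)
  moreover have "act M \<one>\<^bsub>B\<^esub> (act M \<one>\<^bsub>B\<^esub> a) = act M \<one>\<^bsub>B\<^esub> a"
    using act_act[of "\<one>\<^bsub>B\<^esub>" "\<one>\<^bsub>B\<^esub>" a] a by simp
  ultimately show ?thesis using a by (simp add: inj_on_def)
qed

lemma act_one [simp]: "x \<in> carrier B \<Longrightarrow> act M x \<one>\<^bsub>K\<^esub> = \<one>\<^bsub>K\<^esub>"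
  using act_mult[of x "\<one>\<^bsub>K\<^esub>" "\<one>\<^bsub>K\<^esub>"] by (simp del: act_mult)

end

lemma is_category_S_PreXMod: "is_category S_PreXMod"
  unfolding is_category_def
proof (intro conjI ballI)
  fix M :: "'u xmod" assume "M \<in> obj S_PreXMod"
  then interpret pre_xmod M by unfold_locales simp
  have "(rpo_id B, rpo_id K) \<in> xmod_homs M M"
    by (intro xmod_homsI rpo_id_in_hom base_rpo dom_rpo) (simp_all add: rpo_id_def)
  then show "ident S_PreXMod M \<in> arr S_PreXMod M M" by simp
next
  fix M N L :: "'u xmod" and f g
  assume M: "M \<in> obj S_PreXMod" and "f \<in> arr S_PreXMod M N" "g \<in> arr S_PreXMod N L"
  moreover obtain f0 f1 g0 g1 where fg: "f = (f0, f1)" "g = (g0, g1)" by fastforce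
  ultimately have f: "(f0, f1) \<in> xmod_homs M N" and g: "(g0, g1) \<in> xmod_homs N L"
    by simp_all
  note f' = xmod_homsD[OF f] and g' = xmod_homsD[OF g]
  interpret pre_xmod M using M by unfold_locales simp
  have "(compose (carrier B) g0 f0, compose (carrier K) g1 f1) \<in> xmod_homs M L"
    using f' g'
    by (intro xmod_homsI)
      (simp_all add: compose_eq rpo_hom_carrier[OF f'(1)] rpo_hom_carrier[OF f'(2)]
        rpo_hom_compose[OF base_rpo f'(1) g'(1)] rpo_hom_compose[OF dom_rpo f'(2) g'(2)])
  then show "comp_at S_PreXMod M N L g f \<in> arr S_PreXMod M L" by (simp add: fg)
next
  fix M N :: "'u xmod" and f
  assume "f \<in> arr S_PreXMod M N"
  then show "comp_at S_PreXMod M M N f (ident S_PreXMod M) = f"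
    "comp_at S_PreXMod M N N (ident S_PreXMod N) f = f"
    using xmod_homsD(1,2)[of "fst f" "snd f" M N]
    by (cases f; simp add: compose_rpo_id_left compose_rpo_id_right)+
next
  fix M N L K :: "'u xmod" and f g h
  assume "f \<in> arr S_PreXMod M N"
  then show "comp_at S_PreXMod M N K (comp_at S_PreXMod N L K h g) f =
      comp_at S_PreXMod M L K h (comp_at S_PreXMod M N L g f)"
    using xmod_homsD(1,2)[of "fst f" "snd f" M N]
    by (cases f; cases g; cases h) (simp add: compose_assoc_rpo)
qed

lemma S_XMod_simps [simp]:
  "M \<in> obj S_XMod \<longleftrightarrow> precrossed_module M \<and> peiffer M"
  "arr S_XMod = xmod_homs"
  "ident S_XMod = ident S_PreXMod"
  "comp_at S_XMod = comp_at S_PreXMod"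
  by (simp_all add: S_XMod_def full_subcategory_def S_PreXMod_def)

lemma is_category_S_XMod: "is_category S_XMod"
  unfolding S_XMod_def by (rule is_category_full_subcategory[OF is_category_S_PreXMod])

section \<open>The kernel functor\<close>

text \<open>The kernel of \<open>dm X\<close> in the category of right-preordered groups. Limits are
  computed separately on cones, so its cone is the trace of the cone of arrows.\<close>

definition ker_grp :: "'u intcat \<Rightarrow> 'u rpogroup" where
  "ker_grp X =
     \<lparr>carrier = {a \<in> carrier (ar_grp X). dm X a = \<one>\<^bsub>ob_grp X\<^esub>},
      mult = mult (ar_grp X),
      one = one (ar_grp X),
      pos = {a \<in> pos (ar_grp X). dm X a = \<one>\<^bsub>ob_grp X\<^esub>}\<rparr>"

text \<open>\<open>act\<close> is restricted in both arguments: as a morphism it is extensional, and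
  so are its values, being elements of \<open>rpo_Aut\<close>.\<close>

definition xmod_of :: "'u intcat \<Rightarrow> 'u xmod" where
  "xmod_of X =
     \<lparr>base_grp = ob_grp X,
      dom_grp = ker_grp X,
      bd = restrict (cd X) (carrier (ker_grp X)),
      act = (\<lambda>x\<in>carrier (ob_grp X). \<lambda>k\<in>carrier (ker_grp X).
        idn X x \<otimes>\<^bsub>ar_grp X\<^esub> k \<otimes>\<^bsub>ar_grp X\<^esub> inv\<^bsub>ar_grp X\<^esub> idn X x)\<rparr>"

definition ker_functor ::
  "('u intcat, ('u \<Rightarrow> 'u) \<times> ('u \<Rightarrow> 'u), 'u xmod, ('u \<Rightarrow> 'u) \<times> ('u \<Rightarrow> 'u)) functor_data" where
  "ker_functor =
     \<lparr>on_obj = xmod_of,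
      on_arr = (\<lambda>X Y (f0, f1). (f0, restrict f1 (carrier (ker_grp X))))\<rparr>"

lemma ker_grp_simps [simp]:
  "a \<in> carrier (ker_grp X) \<longleftrightarrow> a \<in> carrier (ar_grp X) \<and> dm X a = \<one>\<^bsub>ob_grp X\<^esub>"
  "a \<in> pos (ker_grp X) \<longleftrightarrow> a \<in> pos (ar_grp X) \<and> dm X a = \<one>\<^bsub>ob_grp X\<^esub>"
  "mult (ker_grp X) = mult (ar_grp X)"
  "one (ker_grp X) = one (ar_grp X)"
  by (simp_all add: ker_grp_def)

lemma xmod_of_simps [simp]:
  "base_grp (xmod_of X) = ob_grp X"
  "dom_grp (xmod_of X) = ker_grp X"
  "a \<in> carrier (ker_grp X) \<Longrightarrow> bd (xmod_of X) a = cd X a"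
  "x \<in> carrier (ob_grp X) \<Longrightarrow> a \<in> carrier (ker_grp X) \<Longrightarrow> act (xmod_of X) x a =
    idn X x \<otimes>\<^bsub>ar_grp X\<^esub> a \<otimes>\<^bsub>ar_grp X\<^esub> inv\<^bsub>ar_grp X\<^esub> idn X x"
  by (simp_all add: xmod_of_def del: ker_grp_simps)

section \<open>From Schreier categories to crossed modules\<close>

context int_cat
begin

text \<open>A retraction of the arrows onto the kernel of \<open>dm X\<close>. It is in general no
  homomorphism, only a crossed one; see \<open>ker_part_mult\<close>.\<close>

abbreviation ker_part :: "'u \<Rightarrow> 'u" where
  "ker_part a \<equiv> a \<otimes>\<^bsub>Ar\<^esub> inv\<^bsub>Ar\<^esub> idn X (dm X a)"

lemma group_ker_grp: "group (ker_grp X)"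
proof (rule groupI)
  fix a assume "a \<in> carrier (ker_grp X)"
  then show "\<exists>b\<in>carrier (ker_grp X). b \<otimes>\<^bsub>ker_grp X\<^esub> a = \<one>\<^bsub>ker_grp X\<^esub>"
    by (intro bexI[of _ "inv\<^bsub>Ar\<^esub> a"]) simp_all
qed (simp_all add: Ar.m_assoc)

lemma ker_grp_rpo: "is_rpogroup (ker_grp X)"
  using ar_rpo
  by (intro is_rpogroupI group_ker_grp) (simp_all add: pos_carrier pos_mult pos_one)

lemma inv_ker_grp: "a \<in> carrier (ker_grp X) \<Longrightarrow> inv\<^bsub>ker_grp X\<^esub> a = inv\<^bsub>Ar\<^esub> a"
  by (rule group.inv_equality[OF group_ker_grp]) simp_all

lemma conj_in_Aut:
  assumes x: "x \<in> carrier Ob"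
  shows "act (xmod_of X) x \<in> carrier (rpo_Aut (ker_grp X))"
proof -
  have "bij_betw (act (xmod_of X) x) (carrier (ker_grp X)) (carrier (ker_grp X))"
    by (rule bij_betw_byWitness[of _ "\<lambda>k. inv\<^bsub>Ar\<^esub> idn X x \<otimes>\<^bsub>Ar\<^esub> k \<otimes>\<^bsub>Ar\<^esub> idn X x"])
      (use x in \<open>auto simp: Ar.m_assoc simp del: e.hom_inv\<close>)
  moreover have "act (xmod_of X) x \<in> extensional (carrier (ker_grp X))"
    using x by (simp add: xmod_of_def)
  ultimately show ?thesis
    using x by (auto simp: rpo_Aut_carrier hom_def Ar.m_assoc)
qed

end

locale schreier_cat =
  fixes X :: "'u intcat"
  assumes schreier: "schreier_category X"

sublocale schreier_cat \<subseteq> int_cat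
  using schreier by unfold_locales (simp add: schreier_category_def)

context schreier_cat
begin

lemma ker_part_pos: "a \<in> pos Ar \<Longrightarrow> ker_part a \<in> pos Ar"
  using schreier by (simp add: schreier_category_def schreier_split_epi_def)

lemma act_xmod_of_hom: "act (xmod_of X) \<in> rpo_hom Ob (rpo_Aut (ker_grp X))"
proof (rule rpo_homI)
  show "act (xmod_of X) \<in> extensional (carrier Ob)" by (simp add: xmod_of_def)
  show Aut: "act (xmod_of X) x \<in> carrier (rpo_Aut (ker_grp X))" if "x \<in> carrier Ob" for x
    using conj_in_Aut[OF that] .
  fix x
  {
    fix y assume x: "x \<in> carrier Ob" and y: "y \<in> carrier Ob"
    have "act (xmod_of X) (x \<otimes>\<^bsub>Ob\<^esub> y) =
        compose (carrier (ker_grp X)) (act (xmod_of X) x) (act (xmod_of X) y)"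
    proof (rule extensionalityI)
      show "act (xmod_of X) (x \<otimes>\<^bsub>Ob\<^esub> y) \<in> extensional (carrier (ker_grp X))"
        using Aut x y by (simp add: rpo_Aut_carrier)
    qed (use x y in \<open>simp_all add: compose_eq Ar.m_assoc Ar.inv_mult_group\<close>)
    then show "act (xmod_of X) (x \<otimes>\<^bsub>Ob\<^esub> y) =
        act (xmod_of X) x \<otimes>\<^bsub>rpo_Aut (ker_grp X)\<^esub> act (xmod_of X) y"
      using Aut x y by (simp add: rpo_Aut_mult)
  }
  assume x: "x \<in> pos Ob"
  then have xc: "x \<in> carrier Ob" by (rule pos_carrier[OF ob_rpo])
  have "act (xmod_of X) x k \<in> pos (ker_grp X)" if k: "k \<in> pos (ker_grp X)" for k
  proof -
    have kc: "k \<in> carrier Ar" "dm X k = \<one>\<^bsub>Ob\<^esub>" using k pos_carrier[OF ar_rpo] by auto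
    \<comment> \<open>The inverse of \<open>e x\<close> need not be positive. But
      \<open>e x + k\<close> is positive with domain \<open>x\<close>, so its kernel part is exactly
      the conjugate \<open>e x + k - e x\<close>, and the Schreier condition applies.\<close>
    have "idn X x \<otimes>\<^bsub>Ar\<^esub> k \<in> pos Ar"
      using k by (intro pos_mult[OF ar_rpo] rpo_hom_pos[OF idn_hom x]) simp
    from ker_part_pos[OF this] show ?thesis using xc kc by simp
  qed
  then show "act (xmod_of X) x \<in> pos (rpo_Aut (ker_grp X))"
    using Aut[OF xc] by (auto simp: rpo_Aut_pos simp del: ker_grp_simps)
qed

text \<open>The precrossed identity is \<open>c\<close> applied to a conjugate by
  \<open>e x\<close>, using \<open>c (e x) = x\<close>. The Peiffer identity is
  \<open>ker_dm_conj\<close> with both elements in the kernel.\<close>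

lemma crossed_xmod_of: "precrossed_module (xmod_of X)" "peiffer (xmod_of X)"
proof -
  have "bd (xmod_of X) \<in> rpo_hom (ker_grp X) Ob"
  proof (rule rpo_homI)
    show "bd (xmod_of X) \<in> extensional (carrier (ker_grp X))" by (simp add: xmod_of_def)
  qed (use rpo_hom_pos[OF cd_hom] pos_carrier[OF ar_rpo] in simp_all)
  then show "precrossed_module (xmod_of X)"
    using ob_rpo ker_grp_rpo act_xmod_of_hom by (simp add: precrossed_module_def)
  show "peiffer (xmod_of X)"
    using ker_dm_conj by (simp add: peiffer_def inv_ker_grp)
qed

text \<open>This crossed-homomorphism rule says that \<open>a\<close> maps to the pair of
  \<open>ker_part a\<close> and \<open>dm X a\<close> multiplicatively for the semidirect product
  law. It drives multiplicativity in the proof of fullness.\<close>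

lemma ker_part_mult: "a \<in> carrier Ar \<Longrightarrow> b \<in> carrier Ar \<Longrightarrow>
    ker_part (a \<otimes>\<^bsub>Ar\<^esub> b) = ker_part a \<otimes>\<^bsub>Ar\<^esub> act (xmod_of X) (dm X a) (ker_part b)"
  by (simp add: Ar.m_assoc Ar.inv_mult_group)

end

text \<open>Compatibility with \<open>d\<close> keeps kernels inside kernels, compatibility with
  \<open>c\<close> gives the boundary square, and compatibility with \<open>e\<close> gives
  equivariance, since the action is conjugation by identities.\<close>

lemma ker_functor_arr:
  assumes X: "schreier_category X" and Y: "schreier_category Y" and f: "(f0, f1) \<in> internal_functors X Y"
  shows "(f0, restrict f1 (carrier (ker_grp X))) \<in> xmod_homs (xmod_of X) (xmod_of Y)"
proof -
  interpret X: schreier_cat X by unfold_locales (rule X)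
  interpret Y: schreier_cat Y by unfold_locales (rule Y)
  note f' = internal_functorsD[OF f]
  interpret f0: group_hom X.Ob Y.Ob f0 by (rule rpo_hom_group_hom[OF X.ob_rpo Y.ob_rpo f'(1)])
  interpret f1: group_hom X.Ar Y.Ar f1 by (rule rpo_hom_group_hom[OF X.ar_rpo Y.ar_rpo f'(2)])
  show ?thesis
  proof (rule xmod_homsI)
    show "restrict f1 (carrier (ker_grp X)) \<in> rpo_hom (dom_grp (xmod_of X)) (dom_grp (xmod_of Y))"
      by (rule rpo_homI)
        (use f' in \<open>auto simp: rpo_hom_pos[OF f'(2)] pos_carrier[OF X.ar_rpo]\<close>)
  qed (use f' in \<open>simp_all del: X.e.hom_inv Y.e.hom_inv\<close>)
qed

lemma is_functor_ker_functor: "is_functor SchCat S_XMod ker_functor"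
  unfolding is_functor_def
proof (intro conjI ballI)
  fix X :: "'u intcat" assume "X \<in> obj SchCat"
  then interpret schreier_cat X by unfold_locales simp
  show "on_obj ker_functor X \<in> obj S_XMod"
    using crossed_xmod_of by (simp add: ker_functor_def)
  show "on_arr ker_functor X X (ident SchCat X) = ident S_XMod (on_obj ker_functor X)"
    by (auto simp: ker_functor_def rpo_id_def restrict_def)
next
  fix X Y :: "'u intcat" and f
  assume "X \<in> obj SchCat" "Y \<in> obj SchCat" "f \<in> arr SchCat X Y"
  then show "on_arr ker_functor X Y f \<in> arr S_XMod (on_obj ker_functor X) (on_obj ker_functor Y)"
    using ker_functor_arr by (cases f) (simp add: ker_functor_def)
next
  fix X Y Z :: "'u intcat" and f g
  assume X: "X \<in> obj SchCat" and Y: "Y \<in> obj SchCat" and f: "f \<in> arr SchCat X Y"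
  \<comment> \<open>Needed so that the restriction of a composite is the composite of the
    restrictions.\<close>
  have "f1 a \<in> carrier (ker_grp Y)"
    if "f = (f0, f1)" "a \<in> carrier (ker_grp X)" for f0 f1 a
    using ker_functor_arr[of X Y f0 f1] X Y f that rpo_hom_carrier[OF xmod_homsD(2)]
    by fastforce
  then show "on_arr ker_functor X Z (comp_at SchCat X Y Z g f) =
      comp_at S_XMod (on_obj ker_functor X) (on_obj ker_functor Y) (on_obj ker_functor Z)
        (on_arr ker_functor Y Z g) (on_arr ker_functor X Y f)"
    by (cases f; cases g) (auto simp: ker_functor_def compose_def fun_eq_iff restrict_def)
qed

section \<open>Faithfulness and fullness\<close>

text \<open>The functor keeps the object component. The value of \<open>f1\<close> at
  \<open>a\<close> is the product of its value at the kernel part and \<open>f1 (e (d a))\<close>,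
  and the latter is determined by \<open>f0\<close>.\<close>

lemma ker_functor_faithful:
  assumes X: "schreier_category X" and Y: "schreier_category Y"
    and f: "(f0, f1) \<in> internal_functors X Y" and g: "(f0, g1) \<in> internal_functors X Y"
    and eq: "restrict f1 (carrier (ker_grp X)) = restrict g1 (carrier (ker_grp X))"
  shows "f1 = g1"
proof (rule rpo_hom_eqI)
  interpret X: schreier_cat X by unfold_locales (rule X)
  note f' = internal_functorsD[OF f] and g' = internal_functorsD[OF g]
  show "f1 \<in> rpo_hom X.Ar (ar_grp Y)" "g1 \<in> rpo_hom X.Ar (ar_grp Y)" by (rule f' g')+
  fix a assume a: "a \<in> carrier X.Ar"
  have k: "X.ker_part a \<in> carrier (ker_grp X)" using a by simp
  have "f1 (X.ker_part a) = g1 (X.ker_part a)"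
    using fun_cong[OF eq, of "X.ker_part a"] k by (simp del: ker_grp_simps)
  then have "f1 (X.ker_part a \<otimes>\<^bsub>X.Ar\<^esub> idn X (dm X a)) = g1 (X.ker_part a \<otimes>\<^bsub>X.Ar\<^esub> idn X (dm X a))"
    using a by (simp add: rpo_hom_mult[OF f'(2)] rpo_hom_mult[OF g'(2)] f'(5) g'(5)
        del: X.e.hom_inv X.d.hom_inv)
  then show "f1 a = g1 a" using a by (simp add: X.Ar.m_assoc)
qed

lemma ker_functor_full:
  assumes X: "schreier_category X" and Y: "schreier_category Y"
    and g: "(g0, g1) \<in> xmod_homs (xmod_of X) (xmod_of Y)"
  shows "\<exists>f1. (g0, f1) \<in> internal_functors X Y \<and> restrict f1 (carrier (ker_grp X)) = g1"
proof -
  interpret X: schreier_cat X by unfold_locales (rule X)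
  interpret Y: schreier_cat Y by unfold_locales (rule Y)
  note g' = xmod_homsD[OF g, simplified, simplified]
  interpret g0: group_hom X.Ob Y.Ob g0 by (rule rpo_hom_group_hom[OF X.ob_rpo Y.ob_rpo g'(1)])
  interpret g1: group_hom "ker_grp X" "ker_grp Y" g1
    by (rule rpo_hom_group_hom[OF X.ker_grp_rpo Y.ker_grp_rpo g'(2)])
  have g1: "g1 a \<in> carrier Y.Ar" "dm Y (g1 a) = \<one>\<^bsub>Y.Ob\<^esub>" "cd Y (g1 a) = g0 (cd X a)"
    if "a \<in> carrier X.Ar" "dm X a = \<one>\<^bsub>X.Ob\<^esub>" for a
    using g1.hom_closed[of a] g'(3)[of a] that by simp_all
  have g1_act: "g1 (act (xmod_of X) x a) = act (xmod_of Y) (g0 x) (g1 a)"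
    if "x \<in> carrier X.Ob" "a \<in> carrier (ker_grp X)" for x a
    using xmod_homsD(4)[OF g] that by simp
  have g1_one: "g1 \<one>\<^bsub>X.Ar\<^esub> = \<one>\<^bsub>Y.Ar\<^esub>" using g1.hom_one by simp
  \<comment> \<open>The only possible extension of \<open>g1\<close>: apply a homomorphism to the
    splitting of \<open>a\<close>, with its value on identities dictated by
    \<open>g0\<close>.\<close>
  define f1 where "f1 = (\<lambda>a\<in>carrier X.Ar. g1 (X.ker_part a) \<otimes>\<^bsub>Y.Ar\<^esub> idn Y (g0 (dm X a)))"
  have kp: "X.ker_part a \<in> carrier X.Ar" "dm X (X.ker_part a) = \<one>\<^bsub>X.Ob\<^esub>"
    "X.ker_part a \<in> carrier (ker_grp X)"
    "cd X (X.ker_part a) = cd X a \<otimes>\<^bsub>X.Ob\<^esub> inv\<^bsub>X.Ob\<^esub> dm X a"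
    if "a \<in> carrier X.Ar" for a
    using that by simp_all
  \<comment> \<open>For the codomain, \<open>g0 (c a - d a) + g0 (d a)\<close> telescopes to
    \<open>g0 (c a)\<close>.\<close>
  have f1: "f1 a = g1 (X.ker_part a) \<otimes>\<^bsub>Y.Ar\<^esub> idn Y (g0 (dm X a))"
    "f1 a \<in> carrier Y.Ar" "dm Y (f1 a) = g0 (dm X a)" "cd Y (f1 a) = g0 (cd X a)"
    if "a \<in> carrier X.Ar" for a
    using that g1[OF kp(1,2)[OF that]] kp(4)[OF that]
    by (simp_all add: f1_def Y.Ob.m_assoc del: X.e.hom_inv X.d.hom_inv)
  have f1_mult: "f1 (a \<otimes>\<^bsub>X.Ar\<^esub> b) = f1 a \<otimes>\<^bsub>Y.Ar\<^esub> f1 b"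
    if a: "a \<in> carrier X.Ar" and b: "b \<in> carrier X.Ar" for a b
  proof -
    have act: "act (xmod_of X) (dm X a) (X.ker_part b) \<in> carrier (ker_grp X)"
      using a b by simp
    \<comment> \<open>Equivariance of \<open>g1\<close> carries the twist in
      \<open>ker_part_mult\<close> to the action in \<open>Y\<close>, which is conjugation by
      \<open>e (g0 (d a))\<close>; this is the middle factor of the product of \<open>f1 a\<close>
      and \<open>f1 b\<close>.\<close>
    have "g1 (X.ker_part (a \<otimes>\<^bsub>X.Ar\<^esub> b)) =
        g1 (X.ker_part a) \<otimes>\<^bsub>Y.Ar\<^esub> act (xmod_of Y) (g0 (dm X a)) (g1 (X.ker_part b))"
      unfolding X.ker_part_mult[OF a b] using g1.hom_mult[OF kp(3)[OF a] act]
        g1_act[OF _ kp(3)[OF b], of "dm X a"] a by (simp del: xmod_of_simps(4))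
    then show ?thesis
      using a b g1[OF kp(1,2)[OF a]] g1[OF kp(1,2)[OF b]]
      by (simp add: f1 Y.Ar.m_assoc del: X.e.hom_inv X.d.hom_inv Y.e.hom_inv)
  qed
  have f1_hom: "f1 \<in> rpo_hom X.Ar Y.Ar"
  proof (rule rpo_homI)
    show "f1 \<in> extensional (carrier X.Ar)" by (simp add: f1_def)
    fix a assume a: "a \<in> pos X.Ar"
    then have ac: "a \<in> carrier X.Ar" by (rule pos_carrier[OF X.ar_rpo])
    \<comment> \<open>\<open>g1\<close> is monotone only on the kernel cone, so the kernel part of
      \<open>a\<close> has to be positive: the Schreier condition of \<open>X\<close>.\<close>
    have "g1 (X.ker_part a) \<in> pos Y.Ar"
      using rpo_hom_pos[OF g'(2), of "X.ker_part a"] X.ker_part_pos[OF a] kp(2)[OF ac] by simp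
    moreover have "idn Y (g0 (dm X a)) \<in> pos Y.Ar"
      using a by (intro rpo_hom_pos[OF Y.idn_hom] rpo_hom_pos[OF g'(1)] rpo_hom_pos[OF X.dm_hom])
    ultimately show "f1 a \<in> pos Y.Ar" using ac by (simp add: f1 pos_mult[OF Y.ar_rpo])
  qed (use f1 f1_mult in simp_all)
  interpret f1: group_hom X.Ar Y.Ar f1 by (rule rpo_hom_group_hom[OF X.ar_rpo Y.ar_rpo f1_hom])
  have f1_idn: "f1 (idn X x) = idn Y (g0 x)" if "x \<in> carrier X.Ob" for x
    using that g1_one by (simp add: f1 del: X.e.hom_inv)
  have "(g0, f1) \<in> internal_functors X Y"
  proof (rule internal_functorsI)
    fix a b assume a: "a \<in> carrier X.Ar" and b: "b \<in> carrier X.Ar" and ab: "dm X a = cd X b"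
    \<comment> \<open>By \<open>cmp_eq\<close> in both categories, composition is expressed by the
      group operations and identities, which \<open>f1\<close> preserves.\<close>
    have "f1 (cmp X (a, b)) = f1 a \<otimes>\<^bsub>Y.Ar\<^esub> inv\<^bsub>Y.Ar\<^esub> (f1 (idn X (dm X a))) \<otimes>\<^bsub>Y.Ar\<^esub> f1 b"
      unfolding X.cmp_eq[OF a b ab] using a b by (simp del: X.e.hom_inv)
    then show "f1 (cmp X (a, b)) = cmp Y (f1 a, f1 b)"
      using Y.cmp_eq[of "f1 a" "f1 b"] a b ab by (simp add: f1(3,4) f1_idn)
  qed (use g'(1) f1_hom f1(3,4) f1_idn in simp_all)
  moreover have "restrict f1 (carrier (ker_grp X)) = g1"
    using rpo_hom_ext[OF g'(2)]
    by (intro extensionalityI[of _ "carrier (ker_grp X)"]) (simp_all add: f1 g1)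
  ultimately show ?thesis by blast
qed

lemma ker_functor_fully_faithful:
  assumes X: "X \<in> obj SchCat" and Y: "Y \<in> obj SchCat"
  shows "bij_betw (on_arr ker_functor X Y) (arr SchCat X Y)
    (arr S_XMod (on_obj ker_functor X) (on_obj ker_functor Y))"
proof (rule bij_betwI')
  fix f g assume fg: "f \<in> arr SchCat X Y" "g \<in> arr SchCat X Y"
  obtain f0 f1 g0 g1 where "f = (f0, f1)" "g = (g0, g1)" by fastforce
  then show "(on_arr ker_functor X Y f = on_arr ker_functor X Y g) = (f = g)"
    using fg X Y ker_functor_faithful[of X Y f0 f1 g1] by (auto simp: ker_functor_def)
next
  fix f assume "f \<in> arr SchCat X Y"
  then show "on_arr ker_functor X Y f \<in> arr S_XMod (on_obj ker_functor X) (on_obj ker_functor Y)"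
    using is_functor_ker_functor X Y unfolding is_functor_def by blast
next
  fix g assume "g \<in> arr S_XMod (on_obj ker_functor X) (on_obj ker_functor Y)"
  then show "\<exists>f\<in>arr SchCat X Y. g = on_arr ker_functor X Y f"
    using ker_functor_full[of X Y "fst g" "snd g"] X Y
    by (cases g) (force simp: ker_functor_def)
qed

section \<open>The semidirect product category\<close>

text \<open>The product cone is forced: in a Schreier category an arrow is positive exactly when its
  kernel part and its domain are.\<close>

definition semidirect :: "'u xmod \<Rightarrow> ('u \<times> 'u) rpogroup" where
  "semidirect M =
     \<lparr>carrier = carrier (dom_grp M) \<times> carrier (base_grp M),
      mult = (\<lambda>(a, x) (b, y). (a \<otimes>\<^bsub>dom_grp M\<^esub> act M x b, x \<otimes>\<^bsub>base_grp M\<^esub> y)),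
      one = (\<one>\<^bsub>dom_grp M\<^esub>, \<one>\<^bsub>base_grp M\<^esub>),
      pos = pos (dom_grp M) \<times> pos (base_grp M)\<rparr>"

lemma semidirect_simps [simp]:
  "carrier (semidirect M) = carrier (dom_grp M) \<times> carrier (base_grp M)"
  "(a, x) \<otimes>\<^bsub>semidirect M\<^esub> (b, y) = (a \<otimes>\<^bsub>dom_grp M\<^esub> act M x b, x \<otimes>\<^bsub>base_grp M\<^esub> y)"
  "\<one>\<^bsub>semidirect M\<^esub> = (\<one>\<^bsub>dom_grp M\<^esub>, \<one>\<^bsub>base_grp M\<^esub>)"
  "pos (semidirect M) = pos (dom_grp M) \<times> pos (base_grp M)"
  by (simp_all add: semidirect_def)

text \<open>The cone is closed under the twisted product because positive elements of the base act
  by maps preserving the cone of \<open>K\<close>.\<close>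

lemma (in pre_xmod) semidirect_rpo: "is_rpogroup (semidirect M)"
proof (rule is_rpogroupI)
  show "group (semidirect M)"
  proof (rule groupI)
    fix p assume p: "p \<in> carrier (semidirect M)"
    then obtain a x where "p = (a, x)" "a \<in> carrier K" "x \<in> carrier B" by auto
    then show "\<exists>q\<in>carrier (semidirect M). q \<otimes>\<^bsub>semidirect M\<^esub> p = \<one>\<^bsub>semidirect M\<^esub>"
      by (intro bexI[of _ "(act M (inv\<^bsub>B\<^esub> x) (inv\<^bsub>K\<^esub> a), inv\<^bsub>B\<^esub> x)"]) (simp_all flip: act_mult)
  qed (auto simp: K.m_assoc B.m_assoc)
qed (auto simp: pos_carrier[OF dom_rpo] pos_carrier[OF base_rpo] pos_mult[OF dom_rpo]
    pos_mult[OF base_rpo] pos_one[OF dom_rpo] pos_one[OF base_rpo] act_pos)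

text \<open>Structure transport along an injection, with \<open>inv_into UNIV h\<close> as decoder.
  It brings a group of pairs back into the universe.\<close>

definition transport_rpo :: "('a \<Rightarrow> 'b) \<Rightarrow> 'a rpogroup \<Rightarrow> 'b rpogroup" where
  "transport_rpo h G =
     \<lparr>carrier = h ` carrier G,
      mult = (\<lambda>p q. h (inv_into UNIV h p \<otimes>\<^bsub>G\<^esub> inv_into UNIV h q)),
      one = h \<one>\<^bsub>G\<^esub>,
      pos = h ` pos G\<rparr>"

lemma transport_rpo_simps [simp]:
  "carrier (transport_rpo h G) = h ` carrier G"
  "inj h \<Longrightarrow> h x \<otimes>\<^bsub>transport_rpo h G\<^esub> h y = h (x \<otimes>\<^bsub>G\<^esub> y)"
  "\<one>\<^bsub>transport_rpo h G\<^esub> = h \<one>\<^bsub>G\<^esub>"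
  "pos (transport_rpo h G) = h ` pos G"
  by (simp_all add: transport_rpo_def)

lemma is_rpogroup_transport:
  assumes G: "is_rpogroup G" and h: "inj h"
  shows "is_rpogroup (transport_rpo h G)"
proof -
  interpret group G by (rule rpo_group[OF G])
  show ?thesis
  proof (rule is_rpogroupI)
    show "group (transport_rpo h G)"
    proof (rule groupI)
      fix p assume "p \<in> carrier (transport_rpo h G)"
      then obtain x where "p = h x" "x \<in> carrier G" by auto
      then show "\<exists>q\<in>carrier (transport_rpo h G).
          q \<otimes>\<^bsub>transport_rpo h G\<^esub> p = \<one>\<^bsub>transport_rpo h G\<^esub>"
        using h by (intro bexI[of _ "h (inv\<^bsub>G\<^esub> x)"]) simp_all
    qed (use h in \<open>auto simp: m_assoc\<close>)
  qed (use h in \<open>auto simp: pos_carrier[OF G] pos_mult[OF G] pos_one[OF G]\<close>)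
qed

text \<open>The parameter \<open>h\<close> codes pairs as elements of the universe \<open>'u\<close>.\<close>

definition sd_ar :: "('u \<times> 'u \<Rightarrow> 'u) \<Rightarrow> 'u xmod \<Rightarrow> 'u rpogroup" where
  "sd_ar h M = transport_rpo h (semidirect M)"

definition sd_dm :: "('u \<times> 'u \<Rightarrow> 'u) \<Rightarrow> 'u xmod \<Rightarrow> 'u \<Rightarrow> 'u" where
  "sd_dm h M = (\<lambda>p\<in>carrier (sd_ar h M). snd (inv_into UNIV h p))"

definition sd_cd :: "('u \<times> 'u \<Rightarrow> 'u) \<Rightarrow> 'u xmod \<Rightarrow> 'u \<Rightarrow> 'u" where
  "sd_cd h M = (\<lambda>p\<in>carrier (sd_ar h M).
     case inv_into UNIV h p of (a, x) \<Rightarrow> bd M a \<otimes>\<^bsub>base_grp M\<^esub> x)"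

text \<open>The pair \<open>(a, x)\<close> is an arrow from \<open>x\<close> to
  \<open>bd a + x\<close>. The composite is the formula of \<open>cmp_eq\<close>:
  \<open>(a, x) - (0, x) + (b, y)\<close> equals \<open>(a, 0) + (b, y)\<close>, that is
  \<open>(a + b, y)\<close>.\<close>

definition intcat_of :: "('u \<times> 'u \<Rightarrow> 'u) \<Rightarrow> 'u xmod \<Rightarrow> 'u intcat" where
  "intcat_of h M =
     \<lparr>ob_grp = base_grp M,
      ar_grp = sd_ar h M,
      dm = sd_dm h M,
      cd = sd_cd h M,
      idn = (\<lambda>x\<in>carrier (base_grp M). h (\<one>\<^bsub>dom_grp M\<^esub>, x)),
      cmp = (\<lambda>(p, q)\<in>carrier (rpo_pullback (sd_ar h M) (sd_ar h M) (sd_dm h M) (sd_cd h M)).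
        case (inv_into UNIV h p, inv_into UNIV h q) of
          ((a, x), (b, y)) \<Rightarrow> h (a \<otimes>\<^bsub>dom_grp M\<^esub> b, y))\<rparr>"

section \<open>The internal category of a crossed module\<close>

locale coded_xmod = pre_xmod M for M :: "'u xmod" +
  fixes h :: "'u \<times> 'u \<Rightarrow> 'u"
  assumes Peiffer: "peiffer M" and inj_h: "inj h"
begin

abbreviation "X \<equiv> intcat_of h M"

lemma act_bd [simp]: "a \<in> carrier K \<Longrightarrow> b \<in> carrier K \<Longrightarrow>
    act M (bd M a) b = a \<otimes>\<^bsub>K\<^esub> b \<otimes>\<^bsub>K\<^esub> inv\<^bsub>K\<^esub> a"
  using Peiffer by (simp add: peiffer_def)

lemma h_eq [simp]: "h p = h q \<longleftrightarrow> p = q"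
  using inj_h by (simp add: inj_eq)

lemma h_mem [simp]: "h p \<in> h ` S \<longleftrightarrow> p \<in> S"
  using inj_h by (simp add: inj_image_mem_iff)

lemma X_simps [simp]:
  "ob_grp X = B"
  "carrier (ar_grp X) = h ` (carrier K \<times> carrier B)"
  "pos (ar_grp X) = h ` (pos K \<times> pos B)"
  "\<one>\<^bsub>ar_grp X\<^esub> = h (\<one>\<^bsub>K\<^esub>, \<one>\<^bsub>B\<^esub>)"
  "h (a, x) \<otimes>\<^bsub>ar_grp X\<^esub> h (b, y) = h (a \<otimes>\<^bsub>K\<^esub> act M x b, x \<otimes>\<^bsub>B\<^esub> y)"
  "a \<in> carrier K \<Longrightarrow> x \<in> carrier B \<Longrightarrow> dm X (h (a, x)) = x"
  "a \<in> carrier K \<Longrightarrow> x \<in> carrier B \<Longrightarrow> cd X (h (a, x)) = bd M a \<otimes>\<^bsub>B\<^esub> x"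
  "x \<in> carrier B \<Longrightarrow> idn X x = h (\<one>\<^bsub>K\<^esub>, x)"
  using inj_h by (simp_all add: intcat_of_def sd_ar_def sd_dm_def sd_cd_def)

lemma cmp_X [simp]:
  "a \<in> carrier K \<Longrightarrow> x \<in> carrier B \<Longrightarrow> b \<in> carrier K \<Longrightarrow> y \<in> carrier B \<Longrightarrow> x = bd M b \<otimes>\<^bsub>B\<^esub> y \<Longrightarrow>
    cmp X (h (a, x), h (b, y)) = h (a \<otimes>\<^bsub>K\<^esub> b, y)"
  using inj_h
  by (simp add: intcat_of_def rpo_pullback_def sd_ar_def sd_dm_def sd_cd_def)

text \<open>The domain of the first arrow is the codomain of the second, so a composable pair has
  three free parameters.\<close>

lemma composables_X:
  assumes "pq \<in> carrier (composables X)"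
  obtains a b y where "a \<in> carrier K" "b \<in> carrier K" "y \<in> carrier B"
    "pq = (h (a, bd M b \<otimes>\<^bsub>B\<^esub> y), h (b, y))"
  using assms by (cases pq) auto

lemma ar_X_rpo: "is_rpogroup (ar_grp X)"
  using is_rpogroup_transport[OF semidirect_rpo inj_h] by (simp add: intcat_of_def sd_ar_def)

lemmas in_carrier = pos_carrier[OF dom_rpo] pos_carrier[OF base_rpo]
lemmas in_pos = pos_mult[OF dom_rpo] pos_mult[OF base_rpo] pos_one[OF dom_rpo] pos_one[OF base_rpo]

lemma dm_X_hom: "dm X \<in> rpo_hom (ar_grp X) B"
proof (rule rpo_homI)
  show "dm X \<in> extensional (carrier (ar_grp X))" by (simp add: intcat_of_def sd_dm_def)
qed (auto simp: in_carrier)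

text \<open>Multiplicativity is the precrossed identity: \<open>bd (act x b) + x\<close> equals
  \<open>x + bd b\<close>.\<close>

lemma cd_X_hom: "cd X \<in> rpo_hom (ar_grp X) B"
proof (rule rpo_homI)
  show "cd X \<in> extensional (carrier (ar_grp X))" by (simp add: intcat_of_def sd_cd_def)
qed (auto simp: in_carrier in_pos rpo_hom_pos[OF bd_hom] bd_act B.m_assoc)

lemma idn_X_hom: "idn X \<in> rpo_hom B (ar_grp X)"
proof (rule rpo_homI)
  show "idn X \<in> extensional (carrier B)" by (simp add: intcat_of_def)
qed (auto simp: in_carrier in_pos)

lemma cmp_X_hom: "cmp X \<in> rpo_hom (composables X) (ar_grp X)"
proof (rule rpo_homI)
  show "cmp X \<in> extensional (carrier (composables X))"
    by (simp add: intcat_of_def composables_def)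
  show "cmp X p \<in> carrier (ar_grp X)" if "p \<in> carrier (composables X)" for p
    using that by (auto elim!: composables_X)
  show "cmp X (p \<otimes>\<^bsub>composables X\<^esub> q) = cmp X p \<otimes>\<^bsub>ar_grp X\<^esub> cmp X q"
    if p: "p \<in> carrier (composables X)" and q: "q \<in> carrier (composables X)" for p q
  proof -
    from p obtain a b y where p': "a \<in> carrier K" "b \<in> carrier K" "y \<in> carrier B"
      "p = (h (a, bd M b \<otimes>\<^bsub>B\<^esub> y), h (b, y))" by (rule composables_X)
    from q obtain a' b' y' where q': "a' \<in> carrier K" "b' \<in> carrier K" "y' \<in> carrier B"
      "q = (h (a', bd M b' \<otimes>\<^bsub>B\<^esub> y'), h (b', y'))" by (rule composables_X)
    \<comment> \<open>The precrossed identity \<open>bd_act\<close> makes the product pair visibly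
      composable. Equality of the values is the Peiffer identity \<open>act_bd\<close>: acting by
      \<open>bd b\<close> is conjugation by \<open>b\<close>, so
      \<open>act (bd b) (act y a') + b\<close> becomes \<open>b + act y a'\<close>.\<close>
    show ?thesis using p' q' by (simp add: bd_act B.m_assoc K.m_assoc)
  qed
  show "cmp X p \<in> pos (ar_grp X)" if "p \<in> pos (composables X)" for p
    using that by (cases p) (auto simp: in_carrier in_pos)
qed

lemma internal_category_X: "internal_category X"
  unfolding internal_category_def
proof (intro conjI)
  show "\<forall>(p, q)\<in>carrier (composables X). dm X (cmp X (p, q)) = dm X q \<and> cd X (cmp X (p, q)) = cd X p"
    by (auto simp: B.m_assoc)
  show "\<forall>p q r. (p, q) \<in> carrier (composables X) \<and> (q, r) \<in> carrier (composables X) \<longrightarrow>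
      cmp X (cmp X (p, q), r) = cmp X (p, cmp X (q, r))"
    by (auto simp: K.m_assoc B.m_assoc)
qed (use base_rpo ar_X_rpo dm_X_hom cd_X_hom idn_X_hom cmp_X_hom in auto)

lemma inv_idn_X:
  assumes "x \<in> carrier B"
  shows "inv\<^bsub>ar_grp X\<^esub> h (\<one>\<^bsub>K\<^esub>, x) = h (\<one>\<^bsub>K\<^esub>, inv\<^bsub>B\<^esub> x)"
  using group_hom.hom_inv[OF rpo_hom_group_hom[OF base_rpo ar_X_rpo idn_X_hom], of x] assms by simp

text \<open>The kernel part of \<open>(a, x)\<close> is \<open>(a, 0)\<close>, positive as soon as
  \<open>a\<close> is.\<close>

lemma schreier_X: "schreier_category X"
  unfolding schreier_category_def schreier_split_epi_def
  using internal_category_X dm_X_hom idn_X_hom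
  by (auto simp: in_carrier in_pos inv_idn_X)

text \<open>The kernel of the domain map consists of the pairs \<open>(a, 0)\<close>. Its boundary
  is \<open>bd a\<close>, and conjugating by \<open>(0, x)\<close> gives
  \<open>(act x a, 0)\<close>, so dropping the second component recovers \<open>M\<close>.\<close>

lemma ker_X_iso: "is_iso S_XMod (xmod_of X) M
    (rpo_id B, \<lambda>p\<in>carrier (ker_grp X). fst (inv_into UNIV h p))"
proof -
  let ?f = "\<lambda>p\<in>carrier (ker_grp X). fst (inv_into UNIV h p)" and ?g = "\<lambda>a\<in>carrier K. h (a, \<one>\<^bsub>B\<^esub>)"
  have ker: "p \<in> carrier (ker_grp X) \<longleftrightarrow> (\<exists>a\<in>carrier K. p = h (a, \<one>\<^bsub>B\<^esub>))" for p
    by auto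
  have ker_pos: "p \<in> pos (ker_grp X) \<longleftrightarrow> (\<exists>a\<in>pos K. p = h (a, \<one>\<^bsub>B\<^esub>))" for p
    by (auto simp: in_carrier in_pos)
  have ker_h: "h (a, \<one>\<^bsub>B\<^esub>) \<in> carrier (ker_grp X)" if "a \<in> carrier K" for a
    using that by auto
  \<comment> \<open>From here on, membership in the kernel is rewritten by the explicit descriptions
    \<open>ker\<close> and \<open>ker_pos\<close>.\<close>
  note [simp del] = ker_grp_simps(1,2)
  have f: "(rpo_id B, ?f) \<in> xmod_homs (xmod_of X) M"
  proof (rule xmod_homsI)
    show "?f \<in> rpo_hom (dom_grp (xmod_of X)) (dom_grp M)"
      by (rule rpo_homI) (auto simp: ker_h ker ker_pos in_carrier inj_h)
  qed (auto simp: rpo_id_in_hom[OF base_rpo, unfolded rpo_id_def] ker_h ker rpo_id_def inj_h inv_idn_X)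
  have g: "(rpo_id B, ?g) \<in> xmod_homs M (xmod_of X)"
  proof (rule xmod_homsI)
    show "?g \<in> rpo_hom (dom_grp M) (dom_grp (xmod_of X))"
      by (rule rpo_homI) (auto simp: ker_h ker_pos in_carrier)
  qed (auto simp: rpo_id_in_hom[OF base_rpo, unfolded rpo_id_def] ker_h rpo_id_def inv_idn_X)
  have "compose (carrier B) (rpo_id B) (rpo_id B) = rpo_id B"
    by (rule compose_rpo_id_left[OF rpo_id_in_hom[OF base_rpo]])
  moreover have "compose (carrier (ker_grp X)) ?g ?f = rpo_id (ker_grp X)"
    by (auto simp: compose_def rpo_id_def ker inj_h ker_h intro!: restrict_ext)
  moreover have "compose (carrier K) ?f ?g = rpo_id K"
    by (auto simp: compose_def rpo_id_def ker_h inj_h intro!: restrict_ext)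
  ultimately show ?thesis
    unfolding is_iso_def using f g by (auto intro!: bexI[of _ "(rpo_id B, ?g)"])
qed

end

theorem mainTheorem15:
  assumes "infinite (UNIV :: 'u set)"
  shows "equivalent_categories
    (S_XMod :: ('u xmod, ('u \<Rightarrow> 'u) \<times> ('u \<Rightarrow> 'u)) category)
    (SchCat :: ('u intcat, ('u \<Rightarrow> 'u) \<times> ('u \<Rightarrow> 'u)) category)"
proof -
  \<comment> \<open>An infinite set is equinumerous with its square; only injectivity of the coding
    is retained.\<close>
  obtain h :: "'u \<times> 'u \<Rightarrow> 'u" where h: "inj h"
    using card_of_Times_same_infinite[OF assms]
    by (auto simp: bij_betw_def dest!: card_of_ordIso[THEN iffD2])
  have "equivalent_categories (SchCat :: ('u intcat, _) category) (S_XMod :: ('u xmod, _) category)"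
  proof (rule equivalence_of_fully_faithful_essentially_surjective[OF is_category_SchCat
        is_category_S_XMod is_functor_ker_functor ker_functor_fully_faithful])
    fix M :: "'u xmod" assume "M \<in> obj S_XMod"
    then interpret coded_xmod M h using h by unfold_locales simp_all
    show "\<exists>X\<in>obj SchCat. \<exists>f. is_iso S_XMod (on_obj ker_functor X) M f"
      using schreier_X ker_X_iso by (intro bexI[of _ X] exI) (simp_all add: ker_functor_def)
  qed
  then show ?thesis by (rule equivalent_categories_sym)
qed

end
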